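(* Let $r\neq s$ be integers with $r,s\ge 2$, and let $p,t,n$ be positive integers with $n=3p=r+s+t$ and $p+t+2=n+1$. The monodromy group $G$ of each of the two trees with passport $[r,s,1^t;3^p;n]$ is isomorphic to a semidirect product $$G\cong\begin{cases}A_p^3\rtimes A_4 & \text{if } r\equiv s\equiv 0\pmod 2,\\ A_p^3\rtimes\mathbb{Z}_3 & \text{if } r\equiv s\equiv 1\pmod 2,\\ A_p^3\rtimes(A_4\times\mathbb{Z}_2) & \text{if } r\not\equiv s\pmod 2.\end{cases}$$
   Context: A tree is a bicolored (black/white) plane tree, up to color- and orientation-preserving isomorphism. The passport $[\alpha;\beta;n]$ of a tree with $n$ edges records the partition $\alpha\vdash n$ of black vertex degrees and $\beta\vdash n$ of white vertex degrees ($k^m$ means $k$ repeated $m$ times). Label the edges by $1,\dots,n$; let $\sigma_0\in S_n$ (resp. $\sigma_1$) be the permutation whose cycles are the cyclic orders of edges around the black (resp. white) vertices. The monodromy group is $\langle\sigma_0,\sigma_1\rangle\le S_n$ (well defined up to conjugacy). Under the stated conditions there are exactly two trees with passport $[r,s,1^t;3^p;n]$. $A_m$ is the alternating group and $\mathbb{Z}_m$ the cyclic group of order $m$. *)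

theory Defs
  imports
    "HOL-Library.Multiset"
    "HOL-Combinatorics.Orbits"
    "HOL-Algebra.Sym_Groups"
    "HOL-Algebra.Elementary_Groups"
    "HOL-Algebra.Bij"
begin

section \<open>Bicolored plane trees\<close>

text \<open>
  Edges are pairs (black end, white end), so the underlying graph is simple and bipartite.
  The embedding in the oriented plane is recorded as a rotation system: \<open>black_rot T e\<close> is the
  edge following \<open>e\<close> in the cyclic order around the black end of \<open>e\<close>, and likewise \<open>white_rot\<close>.
  For a tree every choice of cyclic orders is realised by a plane embedding, and these orders
  determine it up to orientation-preserving homeomorphism.
\<close>

record ('b, 'w) bicolored_graph =
  black :: "'b set"
  white :: "'w set"
  edges :: "('b \<times> 'w) set"
  black_rot :: "'b \<times> 'w \<Rightarrow> 'b \<times> 'w"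
  white_rot :: "'b \<times> 'w \<Rightarrow> 'b \<times> 'w"

definition vertices :: "('b, 'w) bicolored_graph \<Rightarrow> ('b + 'w) set" where
  "vertices T = black T <+> white T"

definition adjacency :: "('b, 'w) bicolored_graph \<Rightarrow> (('b + 'w) \<times> ('b + 'w)) set" where
  "adjacency T = (\<Union>(b, w)\<in>edges T. {(Inl b, Inr w), (Inr w, Inl b)})"

definition graph_connected :: "('b, 'w) bicolored_graph \<Rightarrow> bool" where
  "graph_connected T \<longleftrightarrow> (\<forall>x\<in>vertices T. \<forall>y\<in>vertices T. (x, y) \<in> (adjacency T)\<^sup>*)"

definition graph_cycle :: "('b, 'w) bicolored_graph \<Rightarrow> ('b + 'w) list \<Rightarrow> bool" where
  "graph_cycle T xs \<longleftrightarrow> length xs \<ge> 3 \<and> distinct xs \<and>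
     (\<forall>i<length xs. (xs ! i, xs ! (Suc i mod length xs)) \<in> adjacency T)"

definition black_star :: "('b, 'w) bicolored_graph \<Rightarrow> 'b \<Rightarrow> ('b \<times> 'w) set" where
  "black_star T b = {e \<in> edges T. fst e = b}"

definition white_star :: "('b, 'w) bicolored_graph \<Rightarrow> 'w \<Rightarrow> ('b \<times> 'w) set" where
  "white_star T w = {e \<in> edges T. snd e = w}"

text \<open>
  Since \<^const>\<open>cyclic_on\<close> holds only of nonempty sets, every vertex carries an edge; the only trees
  excluded by this and by \<open>edges T \<noteq> {}\<close> are those without edges.
\<close>

definition bicolored_plane_tree :: "('b, 'w) bicolored_graph \<Rightarrow> bool" where
  "bicolored_plane_tree T \<longleftrightarrow>
     finite (black T) \<and> finite (white T) \<and>
     edges T \<subseteq> black T \<times> white T \<and> edges T \<noteq> {} \<and>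
     graph_connected T \<and> (\<nexists>xs. graph_cycle T xs) \<and>
     (\<forall>b\<in>black T. cyclic_on (black_rot T) (black_star T b)) \<and>
     (\<forall>w\<in>white T. cyclic_on (white_rot T) (white_star T w))"

definition passport :: "('b, 'w) bicolored_graph \<Rightarrow> nat multiset \<times> nat multiset \<times> nat" where
  "passport T =
     (image_mset (\<lambda>b. card (black_star T b)) (mset_set (black T)),
      image_mset (\<lambda>w. card (white_star T w)) (mset_set (white T)),
      card (edges T))"

section \<open>Monodromy group\<close>

definition edge_labelling :: "('b, 'w) bicolored_graph \<Rightarrow> ('b \<times> 'w \<Rightarrow> nat) \<Rightarrow> bool" where
  "edge_labelling T lab \<longleftrightarrow> bij_betw lab (edges T) {1..card (edges T)}"

definition relabel ::
  "('b, 'w) bicolored_graph \<Rightarrow> ('b \<times> 'w \<Rightarrow> nat) \<Rightarrow> ('b \<times> 'w \<Rightarrow> 'b \<times> 'w) \<Rightarrow> nat \<Rightarrow> nat" where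
  "relabel T lab f i =
     (if i \<in> {1..card (edges T)} then lab (f (inv_into (edges T) lab i)) else i)"

definition sigma0 :: "('b, 'w) bicolored_graph \<Rightarrow> ('b \<times> 'w \<Rightarrow> nat) \<Rightarrow> nat \<Rightarrow> nat" where
  "sigma0 T lab = relabel T lab (black_rot T)"

definition sigma1 :: "('b, 'w) bicolored_graph \<Rightarrow> ('b \<times> 'w \<Rightarrow> nat) \<Rightarrow> nat \<Rightarrow> nat" where
  "sigma1 T lab = relabel T lab (white_rot T)"

definition monodromy_group ::
  "('b, 'w) bicolored_graph \<Rightarrow> ('b \<times> 'w \<Rightarrow> nat) \<Rightarrow> (nat \<Rightarrow> nat) monoid" where
  "monodromy_group T lab =
     subgroup_generated (sym_group (card (edges T))) {sigma0 T lab, sigma1 T lab}"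

text \<open>
  \<^const>\<open>subgroup_generated\<close> silently drops generators outside the carrier; the following lemma
  shows that none is lost here.
\<close>

lemma relabel_permutes:
  assumes lab: "edge_labelling T lab" and f: "bij_betw f (edges T) (edges T)"
  shows "relabel T lab f permutes {1..card (edges T)}"
proof -
  let ?N = "{1..card (edges T)}"
  have l: "bij_betw lab (edges T) ?N"
    using lab by (simp add: edge_labelling_def)
  have "bij_betw (lab \<circ> f \<circ> inv_into (edges T) lab) ?N ?N"
    using bij_betw_trans[OF bij_betw_inv_into[OF l] bij_betw_trans[OF f l]]
    by (simp add: comp_assoc)
  then have "bij_betw (relabel T lab f) ?N ?N"
    by (rule bij_betw_cong[THEN iffD1, rotated]) (simp add: relabel_def)
  then show ?thesis
    by (rule bij_imp_permutes) (auto simp: relabel_def)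
qed

lemma fibrewise_cyclic_bij:
  assumes "finite E" and "\<And>e. e \<in> E \<Longrightarrow> cyclic_on f {e' \<in> E. g e' = g e}"
  shows "bij_betw f E E"
proof -
  have "f ` E \<subseteq> E"
    using cyclic_on_inI[OF assms(2)] by blast
  moreover have "E \<subseteq> f ` E"
  proof
    fix e assume e: "e \<in> E"
    then have "e \<in> {e' \<in> E. g e' = g e}" and "cyclic_on f {e' \<in> E. g e' = g e}"
      using assms(2) by auto
    then have eq: "orbit f e = {e' \<in> E. g e' = g e}" and "e \<in> orbit f e"
      unfolding cyclic_on_alldef by blast+
    from this(2) show "e \<in> f ` E"
      by (cases rule: orbit.cases) (use e eq in auto)
  qed
  ultimately have "f ` E = E"
    by blast
  with assms(1) show ?thesis
    by (metis bij_betw_def eq_card_imp_inj_on)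
qed

lemma sigma_in_sym_group:
  assumes T: "bicolored_plane_tree T" and "edge_labelling T lab"
  shows "sigma0 T lab \<in> carrier (sym_group (card (edges T)))"
    and "sigma1 T lab \<in> carrier (sym_group (card (edges T)))"
proof -
  have fin: "finite (edges T)"
    using T finite_subset by (fastforce simp: bicolored_plane_tree_def)
  have "bij_betw (black_rot T) (edges T) (edges T)"
    using T by (intro fibrewise_cyclic_bij[where g = fst] fin)
      (auto simp: bicolored_plane_tree_def black_star_def)
  moreover have "bij_betw (white_rot T) (edges T) (edges T)"
    using T by (intro fibrewise_cyclic_bij[where g = snd] fin)
      (auto simp: bicolored_plane_tree_def white_star_def)
  ultimately show "sigma0 T lab \<in> carrier (sym_group (card (edges T)))"
    and "sigma1 T lab \<in> carrier (sym_group (card (edges T)))"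
    using relabel_permutes[OF assms(2)] by (simp_all add: sigma0_def sigma1_def sym_group_def)
qed

section \<open>Semidirect products\<close>

definition semidirect_product ::
  "('a, 'c) monoid_scheme \<Rightarrow> ('h, 'd) monoid_scheme \<Rightarrow> ('h \<Rightarrow> 'a \<Rightarrow> 'a) \<Rightarrow> ('a \<times> 'h) monoid" where
  "semidirect_product N H \<phi> =
     \<lparr>carrier = carrier N \<times> carrier H,
      mult = (\<lambda>(a, h) (b, k). (a \<otimes>\<^bsub>N\<^esub> \<phi> h b, h \<otimes>\<^bsub>H\<^esub> k)),
      one = (\<one>\<^bsub>N\<^esub>, \<one>\<^bsub>H\<^esub>)\<rparr>"

definition iso_to_semidirect_product ::
  "('g, 'e) monoid_scheme \<Rightarrow> ('a, 'c) monoid_scheme \<Rightarrow> ('h, 'd) monoid_scheme \<Rightarrow> bool" where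
  "iso_to_semidirect_product G N H \<longleftrightarrow>
     (\<exists>\<phi>\<in>hom H (AutoGroup N). G \<cong> semidirect_product N H \<phi>)"

end

theory Submission
  imports Defs
begin

text \<open>
  Exactly one white vertex is adjacent to both black hubs, every other white vertex to one hub, and
  all remaining edges end in black leaves. Counting positions around the white vertices suitably
  splits the edges into three sheets of \<open>p\<close> edges: \<open>\<sigma>\<^sub>1\<close> permutes the sheets cyclically, while
  \<open>\<sigma>\<^sub>0\<close> is \<open>(x, y, 1)\<close> with an \<open>r\<close>-cycle \<open>x\<close> and an \<open>s\<close>-cycle \<open>y\<close> meeting in one point (after
  exchanging the hubs if necessary, which selects one of the two trees). The commutators of
  \<open>(x^i, y^i, 1)\<close> and \<open>(y^j, 1, x^j)\<close> are 3-cycles in the first coordinate, and they generate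
  \<open>A\<^sub>p \<times> 1 \<times> 1\<close>. Hence the monodromy group is the preimage, in the wreath product of \<open>S\<^sub>p\<close> with
  \<open>\<int>\<^sub>3\<close>, of the group generated by the parity vector \<open>(r - 1, s - 1, 0)\<close> and the cyclic shift; a
  complement of \<open>A\<^sub>p\<^sup>3\<close> is obtained by using one fixed transposition in each odd coordinate.
\<close>

subsection \<open>Internal semidirect products\<close>

text \<open>The three quotients come from linear algebra over the field with two elements. Modulo
  \<open>A_p^3\<close> the group is generated by a parity vector of length 3 and the cyclic shift.
  If \<open>r\<close> and \<open>s\<close> are odd, the vector vanishes and only the shift is left.
  If both are even, it is (1, 1, 0); with its rotations it spans the four vectors of even weight, on
  which the shift acts as a 3-cycle acts on the Klein four-group inside \<open>A_4\<close>. In the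
  mixed case a vector of weight 1 and its rotations span all eight vectors; (1, 1, 1) is fixed by
  the shift and complements the even ones, hence the extra factor of order 2. Knowing the quotient
  does not yet split the extension: the lifts have to multiply exactly. Lifting every odd entry to
  the same involution works, because such lifts commute and the shift merely permutes their
  coordinates. The numerical hypotheses enter through \<open>r + s = p + 1\<close>. Together with
  connectedness this equation forces the single common white vertex, and thereby the single common
  point of the two cycles.\<close>

lemma group_semidirect_product:
  assumes "group N" and "group H" and \<phi>: "\<phi> \<in> hom H (AutoGroup N)"
  shows "group (semidirect_product N H \<phi>)"
proof -
  interpret N: group N by fact
  interpret H: group H by fact
  interpret \<phi>: group_hom H "AutoGroup N" \<phi>
    using \<phi> N.AutoGroup H.is_group by (simp add: group_hom_def group_hom_axioms_def)
  have auto: "\<phi> h \<in> auto N" if "h \<in> carrier H" for h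
    using \<phi>.hom_closed[OF that] by (simp add: AutoGroup_def)
  have closed: "\<phi> h a \<in> carrier N" if "h \<in> carrier H" "a \<in> carrier N" for h a
    using auto[OF that(1)] that(2) by (auto simp: auto_def hom_def)
  have mult: "\<phi> h (a \<otimes>\<^bsub>N\<^esub> b) = \<phi> h a \<otimes>\<^bsub>N\<^esub> \<phi> h b"
    if "h \<in> carrier H" "a \<in> carrier N" "b \<in> carrier N" for h a b
    using auto[OF that(1)] that by (auto simp: auto_def hom_def)
  have comp: "\<phi> (h \<otimes>\<^bsub>H\<^esub> k) a = \<phi> h (\<phi> k a)"
    if "h \<in> carrier H" "k \<in> carrier H" "a \<in> carrier N" for h k a
    using \<phi>.hom_mult[OF that(1,2)] auto[OF that(1)] auto[OF that(2)] that(3)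
    by (simp add: AutoGroup_def BijGroup_def auto_def compose_def)
  have one: "\<phi> \<one>\<^bsub>H\<^esub> a = a" if "a \<in> carrier N" for a
    using \<phi>.hom_one that by (simp add: AutoGroup_def BijGroup_def)
  show ?thesis
  proof (rule groupI)
    fix x assume "x \<in> carrier (semidirect_product N H \<phi>)"
    then obtain a h where x: "x = (a, h)" "a \<in> carrier N" "h \<in> carrier H"
      by (auto simp: semidirect_product_def)
    have "\<phi> (inv\<^bsub>H\<^esub> h) (inv\<^bsub>N\<^esub> a) \<otimes>\<^bsub>N\<^esub> \<phi> (inv\<^bsub>H\<^esub> h) a = \<one>\<^bsub>N\<^esub>"
      using x mult[of "inv\<^bsub>H\<^esub> h" "inv\<^bsub>N\<^esub> a" a]  mult[of "inv\<^bsub>H\<^esub> h" "\<one>\<^bsub>N\<^esub>" "\<one>\<^bsub>N\<^esub>"]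
      by (metis H.inv_closed N.inv_closed N.l_inv N.l_one N.one_closed N.r_cancel_one closed)
    then show "\<exists>y\<in>carrier (semidirect_product N H \<phi>).
        y \<otimes>\<^bsub>semidirect_product N H \<phi>\<^esub> x = \<one>\<^bsub>semidirect_product N H \<phi>\<^esub>"
      using x closed by (intro bexI[of _ "(\<phi> (inv\<^bsub>H\<^esub> h) (inv\<^bsub>N\<^esub> a), inv\<^bsub>H\<^esub> h)"])
        (auto simp: semidirect_product_def simp del: \<phi>.hom_inv)
  qed (auto simp: semidirect_product_def closed mult comp one N.m_assoc H.m_assoc
      simp del: \<phi>.hom_mult \<phi>.hom_one)
qed

text \<open>Conjugation supplies the action, so none has to be given: \<open>norm\<close> makes its
  values exist, and \<open>inj\<close>, which covers injectivity of both maps and trivial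
  intersection of their images, makes them unique. The products \<open>f a \<otimes> g h\<close>
  then form a subgroup, and the last three hypotheses identify it with
  \<open>generate K X\<close>.\<close>

lemma iso_to_semidirect_product_generated:
  fixes K (structure)
  assumes "group K" and "group N" and "group H"
    and f: "f \<in> hom N K" and g: "g \<in> hom H K"
    and inj: "\<And>a h. a \<in> carrier N \<Longrightarrow> h \<in> carrier H \<Longrightarrow> f a \<otimes> g h = \<one> \<Longrightarrow> a = \<one>\<^bsub>N\<^esub> \<and> h = \<one>\<^bsub>H\<^esub>"
    and norm: "\<And>a h. a \<in> carrier N \<Longrightarrow> h \<in> carrier H \<Longrightarrow> \<exists>b\<in>carrier N. g h \<otimes> f a = f b \<otimes> g h"
    and X: "X \<subseteq> {f a \<otimes> g h |a h. a \<in> carrier N \<and> h \<in> carrier H}"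
    and fN: "f ` carrier N \<subseteq> generate K X" and gH: "g ` carrier H \<subseteq> generate K X"
  shows "iso_to_semidirect_product (subgroup_generated K X) N H"
proof -
  interpret K: group K by fact
  interpret N: group N by fact
  interpret H: group H by fact
  interpret f: group_hom N K f using f by unfold_locales
  interpret g: group_hom H K g using g by unfold_locales
  have finj: "a = b" if "a \<in> carrier N" "b \<in> carrier N" "f a = f b" for a b
  proof -
    have "f (a \<otimes>\<^bsub>N\<^esub> inv\<^bsub>N\<^esub> b) \<otimes> g \<one>\<^bsub>H\<^esub> = \<one>"
      using that by simp
    then show ?thesis
      using inj[of "a \<otimes>\<^bsub>N\<^esub> inv\<^bsub>N\<^esub> b" "\<one>\<^bsub>H\<^esub>"] that
      by (metis H.one_closed N.inv_closed N.inv_equality N.inv_inv N.m_closed)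
  qed
  \<comment> \<open>Restricted to the carrier because members of \<open>AutoGroup N\<close> are
    extensional functions.\<close>
  define \<phi> where "\<phi> h = (\<lambda>a\<in>carrier N. THE b. b \<in> carrier N \<and> g h \<otimes> f a = f b \<otimes> g h)" for h
  have \<phi>: "\<phi> h a \<in> carrier N \<and> g h \<otimes> f a = f (\<phi> h a) \<otimes> g h"
    if h: "h \<in> carrier H" and a: "a \<in> carrier N" for h a
  proof -
    have "\<exists>!b. b \<in> carrier N \<and> g h \<otimes> f a = f b \<otimes> g h"
      using norm[OF a h] finj h by (metis K.right_cancel f.hom_closed g.hom_closed)
    from theI'[OF this] show ?thesis using a by (simp add: \<phi>_def)
  qed
  have \<phi>I: "\<phi> h a = b"
    if "h \<in> carrier H" "a \<in> carrier N" "b \<in> carrier N" "g h \<otimes> f a = f b \<otimes> g h" for h a b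
    using \<phi>[OF that(1,2)] that finj by (metis K.right_cancel f.hom_closed g.hom_closed)
  have comp: "\<phi> (h \<otimes>\<^bsub>H\<^esub> k) a = \<phi> h (\<phi> k a)"
    if h: "h \<in> carrier H" "k \<in> carrier H" "a \<in> carrier N" for h k a
  proof (rule \<phi>I)
    have "g (h \<otimes>\<^bsub>H\<^esub> k) \<otimes> f a = g h \<otimes> (g k \<otimes> f a)"
      using h by (simp add: K.m_assoc)
    also have "\<dots> = (g h \<otimes> f (\<phi> k a)) \<otimes> g k"
      using h \<phi>[of k a] by (simp add: K.m_assoc)
    also have "\<dots> = f (\<phi> h (\<phi> k a)) \<otimes> g (h \<otimes>\<^bsub>H\<^esub> k)"
      using h \<phi>[of k a] \<phi>[of h "\<phi> k a"] by (simp add: K.m_assoc)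
    finally show "g (h \<otimes>\<^bsub>H\<^esub> k) \<otimes> f a = f (\<phi> h (\<phi> k a)) \<otimes> g (h \<otimes>\<^bsub>H\<^esub> k)" .
  qed (use h \<phi> in auto)
  have one: "\<phi> \<one>\<^bsub>H\<^esub> a = a" if "a \<in> carrier N" for a
    using that by (intro \<phi>I) auto
  have mult: "\<phi> h (a \<otimes>\<^bsub>N\<^esub> b) = \<phi> h a \<otimes>\<^bsub>N\<^esub> \<phi> h b"
    if h: "h \<in> carrier H" "a \<in> carrier N" "b \<in> carrier N" for h a b
  proof (rule \<phi>I)
    have "g h \<otimes> f (a \<otimes>\<^bsub>N\<^esub> b) = (g h \<otimes> f a) \<otimes> f b"
      using h by (simp add: K.m_assoc)
    also have "\<dots> = f (\<phi> h a) \<otimes> (g h \<otimes> f b)"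
      using h \<phi>[of h a] by (simp add: K.m_assoc)
    also have "\<dots> = f (\<phi> h a \<otimes>\<^bsub>N\<^esub> \<phi> h b) \<otimes> g h"
      using h \<phi>[of h a] \<phi>[of h b] by (simp add: K.m_assoc)
    finally show "g h \<otimes> f (a \<otimes>\<^bsub>N\<^esub> b) = f (\<phi> h a \<otimes>\<^bsub>N\<^esub> \<phi> h b) \<otimes> g h" .
  qed (use h \<phi> in auto)
  have bij: "bij_betw (\<phi> h) (carrier N) (carrier N)" if h: "h \<in> carrier H" for h
    by (rule bij_betw_byWitness[where f' = "\<phi> (inv\<^bsub>H\<^esub> h)"])
      (use h \<phi> comp[of h "inv\<^bsub>H\<^esub> h"] comp[of "inv\<^bsub>H\<^esub> h" h] one in auto)
  have auto: "\<phi> h \<in> auto N" if "h \<in> carrier H" for h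
    using that \<phi> mult bij by (auto simp: auto_def hom_def Bij_def) (simp add: \<phi>_def)
  have hom: "\<phi> \<in> hom H (AutoGroup N)"
  proof (rule homI)
    fix h k assume hk: "h \<in> carrier H" "k \<in> carrier H"
    have "\<phi> (h \<otimes>\<^bsub>H\<^esub> k) = compose (carrier N) (\<phi> h) (\<phi> k)"
    proof (rule extensionalityI[of _ "carrier N"])
      show "\<phi> (h \<otimes>\<^bsub>H\<^esub> k) \<in> extensional (carrier N)"
        by (simp add: \<phi>_def)
    qed (use comp hk in \<open>auto simp: compose_def\<close>)
    then show "\<phi> (h \<otimes>\<^bsub>H\<^esub> k) = \<phi> h \<otimes>\<^bsub>AutoGroup N\<^esub> \<phi> k"
      using auto[OF hk(1)] auto[OF hk(2)] by (simp add: AutoGroup_def BijGroup_def auto_def)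
  qed (simp add: auto AutoGroup_def)
  let ?S = "semidirect_product N H \<phi>"
  let ?F = "\<lambda>(a, h). f a \<otimes> g h"
  have S: "group ?S"
    using group_semidirect_product[OF N.is_group H.is_group hom] .
  have F_hom: "?F \<in> hom ?S K"
  proof (rule homI)
    fix x y assume "x \<in> carrier ?S" "y \<in> carrier ?S"
    then obtain a h b k where *: "x = (a, h)" "y = (b, k)" "a \<in> carrier N" "h \<in> carrier H"
      "b \<in> carrier N" "k \<in> carrier H"
      by (auto simp: semidirect_product_def)
    have "f (a \<otimes>\<^bsub>N\<^esub> \<phi> h b) \<otimes> g (h \<otimes>\<^bsub>H\<^esub> k) = f a \<otimes> (f (\<phi> h b) \<otimes> g h) \<otimes> g k"
      using * \<phi>[of h b] by (simp add: K.m_assoc)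
    also have "\<dots> = (f a \<otimes> g h) \<otimes> (f b \<otimes> g k)"
      using * \<phi>[of h b] by (simp add: K.m_assoc flip: \<phi>[of h b, THEN conjunct2])
    finally show "?F (x \<otimes>\<^bsub>?S\<^esub> y) = ?F x \<otimes> ?F y"
      using * by (simp add: semidirect_product_def)
  qed (auto simp: semidirect_product_def)
  interpret F: group_hom ?S K ?F
    using S F_hom K.is_group by (simp add: group_hom_def group_hom_axioms_def)
  have X': "X \<subseteq> carrier K"
    using X by force
  have gen: "?F ` carrier ?S = generate K X"
  proof
    show "generate K X \<subseteq> ?F ` carrier ?S"
      using X by (intro K.generate_subgroup_incl F.img_is_subgroup) (force simp: semidirect_product_def)
    show "?F ` carrier ?S \<subseteq> generate K X"
      using fN gH by (auto simp: semidirect_product_def intro!: generate.eng)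
  qed
  have "inj_on ?F (carrier ?S)"
    using inj by (intro F.inj_on_one_iff[THEN iffD2]) (auto simp: semidirect_product_def)
  then have "?F \<in> iso ?S (subgroup_generated K X)"
    using F_hom X' gen by (auto simp: iso_def bij_betw_def hom_def carrier_subgroup_generated Int_absorb1 Pi_iff)
  then have "subgroup_generated K X \<cong> ?S"
    using group.iso_sym[OF S] by (auto simp: is_iso_def)
  then show ?thesis
    using hom by (auto simp: iso_to_semidirect_product_def)
qed

subsection \<open>Products of 3-cycles\<close>

text \<open>Away from \<open>c\<close> the two permutations move different points, so
  \<open>f \<circ> g\<close> and \<open>g \<circ> f\<close> differ only at \<open>c\<close> and at
  the preimages of \<open>c\<close> under \<open>f\<close> and \<open>g\<close>; the 3-cycle
  corrects exactly these three values. Comparing the two products first keeps the inverses out of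
  the pointwise argument.\<close>

lemma commutator_of_permutations_meeting_in_one_point:
  assumes f: "f permutes S" and g: "g permutes S'"
    and c: "f c \<noteq> c" "g c \<noteq> c" and disj: "\<And>z. z \<noteq> c \<Longrightarrow> f z = z \<or> g z = z"
  shows "f \<circ> g \<circ> inv' f \<circ> inv' g = cycle_of_list [c, f c, g c]"
proof -
  have fi: "f u = f v \<longleftrightarrow> u = v" and gi: "g u = g v \<longleftrightarrow> u = v" for u v
    using permutes_inj[OF f] permutes_inj[OF g] by (auto simp: inj_eq)
  \<comment> \<open>If \<open>f\<close> moves \<open>z\<close>, then by injectivity it also moves
    \<open>f z\<close>, so \<open>g\<close> has to fix \<open>f z\<close> unless \<open>z\<close> is
    sent to \<open>c\<close>.\<close>
  have gf: "g (f z) = f z" if "f z \<noteq> z" "f z \<noteq> c" for z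
    using disj[OF that(2)] that fi by auto
  have fg: "f (g z) = g z" if "g z \<noteq> z" "g z \<noteq> c" for z
    using disj[OF that(2)] that gi by auto
  let ?t = "cycle_of_list [c, f c, g c]"
  have ab: "g (f c) = f c" "f (g c) = g c" "f c \<noteq> g c"
    using gf[of c] fg[of c] c fi[of "f c" c] by auto
  have fixed: "?t z = z" if "z \<noteq> c" "z \<noteq> f c" "z \<noteq> g c" for z
    using that by (simp add: transpose_def)
  have t: "?t c = f c" "?t (f c) = g c" "?t (g c) = c"
    using c ab by (auto simp: transpose_def)
  have "f (g z) = ?t (g (f z))" for z
  proof -
    consider "z = c" | "z \<noteq> c" "f z = z" "g z = c" | "z \<noteq> c" "f z = z" "g z \<noteq> c"
      | "z \<noteq> c" "f z \<noteq> z" "f z = c" | "z \<noteq> c" "f z \<noteq> z" "f z \<noteq> c" by blast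
    then show ?thesis
    proof cases
      case 1 then show ?thesis using ab t by simp
    next
      case 2 then show ?thesis using t by simp
    next
      case 3
      have "g z \<noteq> f c" "g z \<noteq> g c"
        using 3 c ab(1) gi[of z "f c"] gi[of z c] fi[of "f c" c] by auto
      moreover have "f (g z) = g z"
        using fg[of z] 3 by (cases "g z = z") auto
      ultimately show ?thesis using 3 fixed[of "g z"] by simp
    next
      case 4
      then have "g z = z" using disj by blast
      then show ?thesis using 4 t by simp
    next
      case 5
      then have "g z = z" using disj by blast
      moreover have "f z \<noteq> f c" "f z \<noteq> g c"
        using 5 c ab(2) fi[of z c] fi[of z "g c"] gi[of "g c" c] \<open>g z = z\<close> by auto
      ultimately show ?thesis using 5 gf[of z] fixed[of "f z"] by simp
    qed
  qed
  then have eq: "f \<circ> g = ?t \<circ> (g \<circ> f)"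
    by (simp add: fun_eq_iff)
  show ?thesis
    unfolding eq using permutes_inv_o[OF f] permutes_inv_o[OF g]
    by (simp add: fun_eq_iff)
qed

lemma three_cycle_apply:
  assumes "distinct [x, y, z]"
  shows "cycle_of_list [x, y, z] x = y" "cycle_of_list [x, y, z] y = z" "cycle_of_list [x, y, z] z = x"
    "t \<notin> {x, y, z} \<Longrightarrow> cycle_of_list [x, y, z] t = t"
  using assms by (auto simp: transpose_def)

lemma three_cycle_reverse:
  assumes "distinct [x, y, z]"
  shows "cycle_of_list [x, z, y] = cycle_of_list [x, y, z] \<circ> cycle_of_list [x, y, z]"
proof
  fix t
  have "distinct [x, z, y]" using assms by auto
  note [simp] = three_cycle_apply[OF this] three_cycle_apply[OF assms]
  show "cycle_of_list [x, z, y] t = (cycle_of_list [x, y, z] \<circ> cycle_of_list [x, y, z]) t"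
    by (cases "t \<in> {x, y, z}") (auto simp del: cycle_of_list.simps)
qed

text \<open>This is a conjugation: the last factor is the inverse of the first, and conjugating by
  the first renames \<open>c\<close>, \<open>v\<close>, \<open>w\<close> to \<open>u\<close>,
  \<open>v\<close>, \<open>c\<close>. It joins two points \<open>u\<close>, \<open>v\<close> lying
  on the same side by means of an auxiliary point \<open>w\<close> on the other side.\<close>

lemma three_cycle_conj:
  assumes "distinct [c, u, v, w]"
  shows "cycle_of_list [c, u, v] =
    cycle_of_list [c, u, w] \<circ> cycle_of_list [c, v, w] \<circ> cycle_of_list [c, w, u]"
proof
  fix t
  have "distinct [c, u, v]" "distinct [c, u, w]" "distinct [c, v, w]" "distinct [c, w, u]"
    using assms by auto
  note [simp] = this[THEN three_cycle_apply(1)] this[THEN three_cycle_apply(2)]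
    this[THEN three_cycle_apply(3)] this[THEN three_cycle_apply(4)]
  have "c \<noteq> u" "c \<noteq> v" "c \<noteq> w" "u \<noteq> v" "u \<noteq> w" "v \<noteq> w"
    using assms by auto
  note [simp] = this this[symmetric]
  consider "t = c" | "t = u" | "t = v" | "t = w" | "t \<notin> {c, u, v, w}" by blast
  then show "cycle_of_list [c, u, v] t =
    (cycle_of_list [c, u, w] \<circ> cycle_of_list [c, v, w] \<circ> cycle_of_list [c, w, u]) t"
    by cases (simp_all del: cycle_of_list.simps)
qed

text \<open>Used to pass from 3-cycles through a base point \<open>c\<close> to those avoiding
  it.\<close>

lemma three_cycle_prod:
  assumes "distinct [c, x, y, z]"
  shows "cycle_of_list [x, y, z] = cycle_of_list [c, z, x] \<circ> cycle_of_list [c, x, y]"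
proof
  fix t
  have "distinct [x, y, z]" "distinct [c, z, x]" "distinct [c, x, y]"
    using assms by auto
  note [simp] = this[THEN three_cycle_apply(1)] this[THEN three_cycle_apply(2)]
    this[THEN three_cycle_apply(3)] this[THEN three_cycle_apply(4)]
  have "c \<noteq> x" "c \<noteq> y" "c \<noteq> z" "x \<noteq> y" "x \<noteq> z" "y \<noteq> z"
    using assms by auto
  note [simp] = this this[symmetric]
  consider "t = c" | "t = x" | "t = y" | "t = z" | "t \<notin> {c, x, y, z}" by blast
  then show "cycle_of_list [x, y, z] t = (cycle_of_list [c, z, x] \<circ> cycle_of_list [c, x, y]) t"
    by cases (simp_all del: cycle_of_list.simps)
qed

text \<open>The given 3-cycles have one point on each side of \<open>c\<close>. Reversal swaps the
  sides, conjugation with an auxiliary point \<open>a0\<close> or \<open>b0\<close> of the opposite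
  side handles two points of the same side, and products then give the 3-cycles that avoid
  \<open>c\<close>. All 3-cycles together generate the alternating group.\<close>

lemma alt_group_subset_of_cycles:
  assumes M: "subgroup M (sym_group n)"
    and AB: "A \<union> B = {1..n}" "A \<inter> B = {c}" "A \<noteq> {c}" "B \<noteq> {c}"
    and cyc: "\<And>a b. a \<in> A - {c} \<Longrightarrow> b \<in> B - {c} \<Longrightarrow> cycle_of_list [c, a, b] \<in> M"
  shows "carrier (alt_group n) \<subseteq> M"
proof -
  have comp: "u \<circ> v \<in> M" if "u \<in> M" "v \<in> M" for u v
    using subgroup.m_closed[OF M that] by (simp add: sym_group_mult)
  have swap: "cycle_of_list [x, z, y] \<in> M"
    if "distinct [x, y, z]" "cycle_of_list [x, y, z] \<in> M" for x y z
    using comp[OF that(2) that(2)] unfolding three_cycle_reverse[OF that(1)] .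
  have rot: "cycle_of_list [y, z, x] = cycle_of_list [x, y, z]" if "distinct [x, y, z]" for x y z :: nat
    using that by (auto simp: fun_eq_iff transpose_def)
  have join: "cycle_of_list [c, u, v] \<in> M"
    if d: "distinct [c, u, v, w]" and M: "cycle_of_list [c, u, w] \<in> M" "cycle_of_list [c, v, w] \<in> M"
    for u v w
  proof -
    have "cycle_of_list [c, w, u] \<in> M"
      using d by (intro swap[OF _ M(1)]) simp
    from comp[OF comp[OF M] this] show ?thesis
      unfolding three_cycle_conj[OF d] .
  qed
  obtain a0 b0 where ab0: "a0 \<in> A - {c}" "b0 \<in> B - {c}"
    using AB by blast
  have through_c: "cycle_of_list [c, u, v] \<in> M"
    if "distinct [c, u, v]" "u \<in> {1..n}" "v \<in> {1..n}" for u v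
  proof -
    have opp: "a \<noteq> b" if "a \<in> A - {c}" "b \<in> B - {c}" for a b
      using that AB(2) by blast
    have cyc': "cycle_of_list [c, b, a] \<in> M" if "a \<in> A - {c}" "b \<in> B - {c}" for a b
      using opp[OF that] that by (intro swap[OF _ cyc]) auto
    have "u \<in> A \<union> B" "v \<in> A \<union> B"
      using that AB(1) by simp_all
    then consider "u \<in> A" "v \<in> A" | "u \<in> A" "v \<in> B" | "u \<in> B" "v \<in> A" | "u \<in> B" "v \<in> B"
      by blast
    then show ?thesis
    proof cases
      case 1
      then have "u \<in> A - {c}" "v \<in> A - {c}" using that by auto
      with that ab0 show ?thesis
        using opp[of u b0] opp[of v b0] by (intro join[of u v b0] cyc) auto
    next
      case 2
      then show ?thesis using that by (intro cyc) auto
    next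
      case 3
      then show ?thesis using that by (intro cyc') auto
    next
      case 4
      then have "u \<in> B - {c}" "v \<in> B - {c}" using that by auto
      with that ab0 show ?thesis
        using opp[of a0 u] opp[of a0 v] by (intro join[of u v a0] cyc') auto
    qed
  qed
  have all: "cycle_of_list [x, y, z] \<in> M"
    if d: "distinct [x, y, z]" and xyz: "{x, y, z} \<subseteq> {1..n}" for x y z
  proof (cases "c \<in> {x, y, z}")
    case True
    then consider "c = x" | "c = y" | "c = z" by blast
    then show ?thesis
    proof cases
      case 1 then show ?thesis
        using d xyz through_c[of y z] by simp
    next
      case 2 then show ?thesis
        using d xyz through_c[of z x] rot[of x y z] by simp
    next
      case 3 then show ?thesis
        using d xyz through_c[of x y] rot[of z x y] by simp
    qed
  next
    case False
    have "distinct [c, x, y, z]" using d False by auto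
    moreover have "cycle_of_list [c, z, x] \<in> M" "cycle_of_list [c, x, y] \<in> M"
      using d xyz False by (auto intro!: through_c simp del: cycle_of_list.simps atLeastAtMost_iff)
    ultimately show ?thesis
      using comp three_cycle_prod[of c x y z] by metis
  qed
  have three: "three_cycles n \<subseteq> M"
  proof
    fix q assume "q \<in> three_cycles n"
    then obtain cs where "q = cycle_of_list cs" "distinct cs" "length cs = 3" "set cs \<subseteq> {1..n}"
      by auto
    moreover then obtain x y z where "cs = [x, y, z]"
      by (auto simp: length_Suc_conv numeral_3_eq_3)
    ultimately show "q \<in> M" using all[of x y z] by simp
  qed
  have "q \<in> M" if "q \<in> generate (alt_group n) (three_cycles n)" for q
    using that
  proof induction
    case one then show ?case
      using subgroup.one_closed[OF M] unfolding alt_group_one sym_group_one .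
  next
    case (incl h) then show ?case using three by blast
  next
    case (inv h)
    then have "h \<in> M" "h \<in> carrier (alt_group n)"
      using three three_cycles_incl by blast+
    then show ?case
      using subgroup.m_inv_closed[OF M] subgroup.mem_carrier[OF M]
      by (metis alt_group_inv_equality sym_group_inv_equality)
  next
    case (eng h1 h2) then show ?case unfolding alt_group_mult using comp by blast
  qed
  then show ?thesis
    unfolding alt_group_carrier_as_three_cycles by blast
qed

text \<open>Listing the orbit of one point writes \<open>x\<close> as a single cycle, which is a
  product of \<open>card A - 1\<close> transpositions.\<close>

lemma evenperm_cyclic_on:
  assumes x: "x permutes S" "finite S" and A: "cyclic_on x A" and out: "\<And>z. z \<notin> A \<Longrightarrow> x z = z"
  shows "evenperm x \<longleftrightarrow> odd (card A)"
proof -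
  have perm: "permutation x"
    using x by (auto simp: permutation_permutes)
  obtain a where a: "a \<in> A" "A = orbit x a"
    using A by (auto simp: cyclic_on_def)
  let ?cs = "support x a"
  have set: "set ?cs = A"
    using support_set[OF perm, of a] a(2) orbit_altdef_permutation[OF perm, of a] by auto
  have cs: "distinct ?cs"
    by (rule cycle_of_permutation[OF perm])
  have "x = cycle_of_list ?cs"
  proof
    fix z show "x z = cycle_of_list ?cs z"
      using cycle_restrict[OF perm, of z a] id_outside_supp[of z ?cs] out[of z] set
      by (cases "z \<in> A") auto
  qed
  then have "swapidseq (card A - 1) x"
    using swapidseq_ext_imp_swapidseq[OF swapidseq_ext_of_cycles[OF cs]] distinct_card[OF cs] set
    by simp
  moreover have "card A > 0"
    using a(1) finite_cyclic_on[OF A] by (auto simp: card_gt_0_iff)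
  ultimately show ?thesis
    by (intro evenperm_unique) auto
qed

subsection \<open>The alternating group on four points\<close>

text \<open>
  Elements of the alternating group on four points are written as triples \<open>(a, b, j)\<close>, standing for
  \<open>V a b \<otimes> s [^] j\<close> with \<open>V\<close> the Klein four-group and \<open>s\<close> a 3-cycle; the relations between \<open>V\<close>
  and \<open>s\<close> determine the multiplication of triples.
\<close>

fun tetra_conj :: "bool \<times> bool \<Rightarrow> bool \<times> bool" where
  "tetra_conj (a, b) = (a \<noteq> b, a)"

fun tetra_mult :: "bool \<times> bool \<times> nat \<Rightarrow> bool \<times> bool \<times> nat \<Rightarrow> bool \<times> bool \<times> nat" where
  "tetra_mult (a, b, i) (a', b', j) =
     (case (tetra_conj ^^ i) (a', b') of (a'', b'') \<Rightarrow> (a \<noteq> a'', b \<noteq> b'', (i + j) mod 3))"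

definition tetra :: "(bool \<times> bool \<times> nat) set" where
  "tetra = UNIV \<times> UNIV \<times> {0, 1, 2}"

definition tetra_eval ::
  "('k, 'm) monoid_scheme \<Rightarrow> (bool \<Rightarrow> bool \<Rightarrow> 'k) \<Rightarrow> 'k \<Rightarrow> bool \<times> bool \<times> nat \<Rightarrow> 'k" where
  "tetra_eval K V s = (\<lambda>(a, b, j). V a b \<otimes>\<^bsub>K\<^esub> s [^]\<^bsub>K\<^esub> j)"

definition tetra_relations ::
  "('k, 'm) monoid_scheme \<Rightarrow> (bool \<Rightarrow> bool \<Rightarrow> 'k) \<Rightarrow> 'k \<Rightarrow> bool" where
  "tetra_relations K V s \<longleftrightarrow>
     (\<forall>a b. V a b \<in> carrier K) \<and> s \<in> carrier K \<and> s [^]\<^bsub>K\<^esub> (3::nat) = \<one>\<^bsub>K\<^esub> \<and>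
     (\<forall>a b a' b'. V a b \<otimes>\<^bsub>K\<^esub> V a' b' = V (a \<noteq> a') (b \<noteq> b')) \<and>
     (\<forall>a b. s \<otimes>\<^bsub>K\<^esub> V a b = V (a \<noteq> b) a \<otimes>\<^bsub>K\<^esub> s)"

lemma (in group) pow_mod_order:
  assumes "s \<in> carrier G" "s [^] (m::nat) = \<one>"
  shows "s [^] (k mod m) = s [^] k"
proof -
  have "s [^] k = s [^] (m * (k div m) + k mod m)"
    by simp
  also have "\<dots> = (s [^] m) [^] (k div m) \<otimes> s [^] (k mod m)"
    using assms(1) by (simp only: nat_pow_mult[symmetric] nat_pow_pow)
  finally show ?thesis
    using assms by simp
qed

lemma (in group) tetra_eval_mult:
  assumes "tetra_relations G V s" 
  shows "tetra_eval G V s (tetra_mult x y) = tetra_eval G V s x \<otimes> tetra_eval G V s y"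
proof -
  have V: "V a b \<in> carrier G" and s: "s \<in> carrier G" "s [^] (3::nat) = \<one>"
    and VV: "V a b \<otimes> V a' b' = V (a \<noteq> a') (b \<noteq> b')" and sV: "s \<otimes> V a b = V (a \<noteq> b) a \<otimes> s"
    for a b a' b'
    using assms unfolding tetra_relations_def by blast+
  \<comment> \<open>Moving one \<open>s\<close> to the right past a Klein element applies
    \<open>tetra_conj\<close> once, so \<open>s [^] i\<close> applies it \<open>i\<close>
    times.\<close>
  have conj: "s [^] i \<otimes> case_prod V c = case_prod V ((tetra_conj ^^ i) c) \<otimes> s [^] i"
    for i :: nat and c
  proof (induction i arbitrary: c)
    case 0 then show ?case using V by (cases c) simp
  next
    case (Suc i)
    obtain a b where c: "c = (a, b)" by force
    have Vc: "case_prod V c' \<in> carrier G" for c' using V by (cases c') simp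
    have "s [^] Suc i \<otimes> case_prod V c = s [^] i \<otimes> case_prod V (tetra_conj c) \<otimes> s"
      using c s V sV by (simp add: m_assoc)
    also have "\<dots> = case_prod V ((tetra_conj ^^ Suc i) c) \<otimes> s [^] Suc i"
      unfolding Suc.IH using s Vc by (simp add: m_assoc funpow_swap1)
    finally show ?case .
  qed
  obtain a b i a' b' j where xy: "x = (a, b, i)" "y = (a', b', j)"
    by (cases x, cases y) force
  obtain a'' b'' where c: "(tetra_conj ^^ i) (a', b') = (a'', b'')" by force
  have "tetra_eval G V s x \<otimes> tetra_eval G V s y = V a b \<otimes> (s [^] i \<otimes> V a' b') \<otimes> s [^] j"
    using xy V s by (simp add: tetra_eval_def m_assoc)
  also have "\<dots> = (V a b \<otimes> V a'' b'') \<otimes> (s [^] i \<otimes> s [^] j)"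
    using conj[of i "(a', b')"] c V s by (simp add: m_assoc)
  also have "\<dots> = V (a \<noteq> a'') (b \<noteq> b'') \<otimes> s [^] ((i + j) mod 3)"
    using s by (simp only: VV nat_pow_mult pow_mod_order)
  finally show ?thesis
    using xy c by (simp add: tetra_eval_def)
qed

text \<open>The order of the two generators matches \<open>tetra_conj\<close>: conjugation by the
  3-cycle (1 2 3) sends (1 2)(3 4) to their product (1 4)(2 3), and (1 3)(2 4) to (1 2)(3
  4).\<close>

definition klein4 :: "bool \<Rightarrow> bool \<Rightarrow> nat \<Rightarrow> nat" where
  "klein4 a b = (if a then transpose 1 2 \<circ> transpose 3 4 else id) \<circ>
     (if b then transpose 1 3 \<circ> transpose 2 4 else id)"

lemma klein4_apply:
  "klein4 False False = (\<lambda>t. t)"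
  "klein4 True False = (\<lambda>t. if t = 1 then 2 else if t = 2 then 1 else if t = 3 then 4 else if t = 4 then 3 else t)"
  "klein4 False True = (\<lambda>t. if t = 1 then 3 else if t = 3 then 1 else if t = 2 then 4 else if t = 4 then 2 else t)"
  "klein4 True True = (\<lambda>t. if t = 1 then 4 else if t = 4 then 1 else if t = 2 then 3 else if t = 3 then 2 else t)"
  by (simp_all add: klein4_def fun_eq_iff transpose_def)

lemma alt_group_4_relations: "tetra_relations (alt_group 4) klein4 (cycle_of_list [1, 2, 3])"
proof -
  have in4: "transpose i j permutes {Suc 0..4}" if "i \<in> {1..4}" "j \<in> {1..4}" for i j :: nat
    using that by (intro permutes_swap_id) auto
  have "klein4 a b \<in> carrier (alt_group 4)" for a b
    unfolding alt_group_carrier klein4_def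
    by (auto intro!: permutes_compose in4
        simp: permutes_id evenperm_comp permutation_swap_id permutation_compose evenperm_swap
        simp del: o_apply)
  moreover have "cycle_of_list [1, 2, 3 :: nat] \<in> carrier (alt_group 4)"
    using three_cycles_incl[of 4] by (rule subsetD) (auto intro!: exI[of _ "[1, 2, 3 :: nat]"])
  moreover have "cycle_of_list [1, 2, 3 :: nat] [^]\<^bsub>alt_group 4\<^esub> (3::nat) = \<one>\<^bsub>alt_group 4\<^esub>"
    by (simp add: numeral_3_eq_3 alt_group_mult alt_group_one fun_eq_iff transpose_def nat_pow_def)
  moreover have "klein4 a b \<otimes>\<^bsub>alt_group 4\<^esub> klein4 a' b' = klein4 (a \<noteq> a') (b \<noteq> b')" for a b a' b'
    unfolding alt_group_mult
    by (cases a; cases b; cases a'; cases b'; simp add: klein4_apply fun_eq_iff)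
  moreover have "cycle_of_list [1, 2, 3] \<otimes>\<^bsub>alt_group 4\<^esub> klein4 a b =
      klein4 (a \<noteq> b) a \<otimes>\<^bsub>alt_group 4\<^esub> cycle_of_list [1, 2, 3]" for a b
    unfolding alt_group_mult
    by (cases a; cases b; simp add: klein4_apply fun_eq_iff transpose_def)
  ultimately show ?thesis
    unfolding tetra_relations_def by blast
qed

text \<open>The 3-cycle fixes 4, so the image of 4 reveals the Klein factor, and after cancelling it
  the image of 1 reveals the exponent. This gives injectivity; surjectivity follows by counting,
  since both sides have 12 elements.\<close>

lemma alt_group_4_tetra:
  "bij_betw (tetra_eval (alt_group 4) klein4 (cycle_of_list [1, 2, 3])) tetra (carrier (alt_group 4))"
  (is "bij_betw ?F _ _")
proof -
  interpret A: group "alt_group 4" by (rule alt_group_is_group)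
  have F: "?F (a, b, j) = klein4 a b \<circ> (cycle_of_list [1, 2, 3] ^^ j)" if "j \<in> {0, 1, 2}" for a b j
    using that by (auto simp: tetra_eval_def alt_group_mult alt_group_one numeral_2_eq_2 nat_pow_def)
  have "?F ` tetra \<subseteq> carrier (alt_group 4)"
    using alt_group_4_relations by (auto simp: tetra_eval_def tetra_relations_def)
  moreover have inj: "inj_on ?F tetra"
  proof (rule inj_onI)
    fix x y assume *: "x \<in> tetra" "y \<in> tetra" "?F x = ?F y"
    obtain a b i a' b' j where xy: "x = (a, b, i)" "y = (a', b', j)" "i \<in> {0, 1, 2}" "j \<in> {0, 1, 2}"
      using * by (auto simp: tetra_def)
    have eq: "(klein4 a b \<circ> (cycle_of_list [1, 2, 3] ^^ i)) t =
        (klein4 a' b' \<circ> (cycle_of_list [1, 2, 3] ^^ j)) t" for t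
      using * xy F by metis
    have "klein4 a b 4 = klein4 a' b' 4"
      using eq[of 4] xy(3,4) by (auto simp: transpose_def numeral_2_eq_2)
    then have ab: "a = a'" "b = b'"
      by (auto simp: klein4_def transpose_def split: if_splits)
    have "inj (klein4 a b)"
      unfolding klein4_def by (auto intro!: inj_compose)
    then have "(cycle_of_list [1, 2, 3] ^^ i) (1::nat) = (cycle_of_list [1, 2, 3] ^^ j) 1"
      using eq[of 1] ab by (simp add: inj_eq)
    then have "i = j"
      using xy(3,4) by (auto simp: transpose_def numeral_2_eq_2)
    then show "x = y" using ab xy by simp
  qed
  moreover have "card tetra = 12"
    by (simp add: tetra_def card_cartesian_product)
  moreover have "card (carrier (alt_group 4)) = 12"
    using alt_group_card_carrier[of 4] by (simp add: fact_numeral)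
  moreover from this have "finite (carrier (alt_group 4))"
    by (intro card_ge_0_finite) simp
  ultimately show ?thesis
    unfolding bij_betw_def by (simp add: card_image card_subset_eq)
qed

text \<open>Each element of \<open>A_4\<close> has a unique triple, and \<open>tetra_mult\<close>
  computes products both in \<open>A_4\<close> and in the target group, so evaluating the triple in
  the target is a homomorphism. The map need not be injective; the last property only records that
  the trivial triple belongs to the identity.\<close>

lemma (in group) alt_group_4_hom:
  assumes rel: "tetra_relations G V s"
  obtains g where "g \<in> hom (alt_group 4) G"
    and "g ` carrier (alt_group 4) = {V a b \<otimes> s [^] j |a b j. j < (3::nat)}"
    and "\<And>q. q \<in> carrier (alt_group 4) \<Longrightarrow>
      \<exists>a b j. j < (3::nat) \<and> g q = V a b \<otimes> s [^] j \<and> (\<not> a \<and> \<not> b \<and> j = 0 \<longrightarrow> q = id)"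
proof
  interpret A: group "alt_group 4" by (rule alt_group_is_group)
  let ?F = "tetra_eval (alt_group 4) klein4 (cycle_of_list [1, 2, 3])"
  let ?g = "\<lambda>q. tetra_eval G V s (inv_into tetra ?F q)"
  have gF: "?g (?F x) = tetra_eval G V s x" if "x \<in> tetra" for x
    using bij_betw_inv_into_left[OF alt_group_4_tetra that] by simp
  have carr: "carrier (alt_group 4) = ?F ` tetra"
    using alt_group_4_tetra by (simp add: bij_betw_def)
  have closed: "tetra_mult x y \<in> tetra" for x y
    by (cases x; cases y) (auto simp: tetra_def split: prod.splits)
  have tetra: "tetra = {(a, b, j). j < 3}"
    by (auto simp: tetra_def)
  show "?g \<in> hom (alt_group 4) G"
  proof (rule homI)
    fix q q' assume "q \<in> carrier (alt_group 4)" "q' \<in> carrier (alt_group 4)"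
    then obtain x y where xy: "x \<in> tetra" "y \<in> tetra" "q = ?F x" "q' = ?F y"
      unfolding carr by auto
    then have "q \<otimes>\<^bsub>alt_group 4\<^esub> q' = ?F (tetra_mult x y)"
      using A.tetra_eval_mult[OF alt_group_4_relations] by simp
    then show "?g (q \<otimes>\<^bsub>alt_group 4\<^esub> q') = ?g q \<otimes> ?g q'"
      using xy gF closed tetra_eval_mult[OF rel] by metis
  next
    fix q assume "q \<in> carrier (alt_group 4)"
    then obtain x where "x \<in> tetra" "q = ?F x"
      unfolding carr by blast
    then have "?g q = tetra_eval G V s x"
      using gF by blast
    then show "?g q \<in> carrier G"
      using rel by (cases x) (auto simp: tetra_relations_def tetra_eval_def)
  qed
  have "?g ` carrier (alt_group 4) = tetra_eval G V s ` tetra"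
    unfolding carr image_image using gF by (intro image_cong) auto
  also have "\<dots> = {V a b \<otimes> s [^] j |a b j. j < (3::nat)}"
    by (force simp: tetra tetra_eval_def)
  finally show "?g ` carrier (alt_group 4) = {V a b \<otimes> s [^] j |a b j. j < (3::nat)}" .
  fix q assume "q \<in> carrier (alt_group 4)"
  then obtain a b j where q: "(a, b, j) \<in> tetra" "q = ?F (a, b, j)"
    unfolding carr by auto
  moreover have "?F (False, False, 0) = id"
    by (simp add: tetra_eval_def klein4_def alt_group_mult alt_group_one)
  ultimately show "\<exists>a b j. j < (3::nat) \<and> ?g q = V a b \<otimes> s [^] j \<and> (\<not> a \<and> \<not> b \<and> j = 0 \<longrightarrow> q = id)"
    using gF[OF q(1)] by (intro exI[of _ a] exI[of _ b] exI[of _ j]) (auto simp: tetra tetra_eval_def)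
qed

subsection \<open>Subgroups of a cyclic wreath product\<close>

text \<open>Only the multiplication rules of the wreath product of \<open>S_m\<close> with the
  cyclic group of order 3 are assumed, inside an ambient group, so that the group theory never
  refers to points. \<open>D_s_trivial\<close> expresses that a normal form represents the identity
  only in the trivial way.\<close>

locale cyclic_wreath = group K for K (structure) +
  fixes m :: nat and D :: "(nat \<Rightarrow> nat) \<Rightarrow> (nat \<Rightarrow> nat) \<Rightarrow> (nat \<Rightarrow> nat) \<Rightarrow> 'a" and s :: 'a
  assumes D_closed: "a permutes {1..m} \<Longrightarrow> b permutes {1..m} \<Longrightarrow> c permutes {1..m} \<Longrightarrow>
      D a b c \<in> carrier K"
    and D_mult: "a permutes {1..m} \<Longrightarrow> b permutes {1..m} \<Longrightarrow> c permutes {1..m} \<Longrightarrow>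
      a' permutes {1..m} \<Longrightarrow> b' permutes {1..m} \<Longrightarrow> c' permutes {1..m} \<Longrightarrow>
      D a b c \<otimes> D a' b' c' = D (a \<circ> a') (b \<circ> b') (c \<circ> c')"
    and s_closed: "s \<in> carrier K" and s_cubed: "s [^] (3::nat) = \<one>"
    and s_D: "a permutes {1..m} \<Longrightarrow> b permutes {1..m} \<Longrightarrow> c permutes {1..m} \<Longrightarrow>
      s \<otimes> D a b c = D c a b \<otimes> s"
    and D_s_trivial: "a permutes {1..m} \<Longrightarrow> b permutes {1..m} \<Longrightarrow> c permutes {1..m} \<Longrightarrow>
      j < (3::nat) \<Longrightarrow> D a b c \<otimes> s [^] j = \<one> \<Longrightarrow> a = id \<and> b = id \<and> c = id \<and> j = 0"
begin

lemma D_id: "D id id id = \<one>"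
proof -
  have "D id id id \<otimes> D id id id = D id id id"
    by (simp add: D_mult permutes_id)
  then show ?thesis
    by (simp add: D_closed permutes_id)
qed

lemma D_inv:
  assumes "a permutes {1..m}" "b permutes {1..m}" "c permutes {1..m}"
  shows "inv (D a b c) = D (inv' a) (inv' b) (inv' c)"
proof (rule inv_equality)
  show "D (inv' a) (inv' b) (inv' c) \<otimes> D a b c = \<one>"
    using assms by (simp add: D_mult permutes_inv permutes_inv_o D_id)
qed (use assms in \<open>simp_all add: D_closed permutes_inv\<close>)

text \<open>The shift permutes the coordinates and conjugation in a coordinate preserves parity, so
  the cube of the alternating group is normalised. The form is the one required by
  \<open>norm\<close> in the recognition criterion.\<close>

lemma D_conj:
  assumes "a permutes {1..m}" "b permutes {1..m}" "c permutes {1..m}"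
    and "u \<in> carrier (alt_group m)" "v \<in> carrier (alt_group m)" "w \<in> carrier (alt_group m)"
  obtains u' v' w' where
    "u' \<in> carrier (alt_group m)" "v' \<in> carrier (alt_group m)" "w' \<in> carrier (alt_group m)"
    "(D a b c \<otimes> s [^] (j::nat)) \<otimes> D u v w = D u' v' w' \<otimes> (D a b c \<otimes> s [^] j)"
proof -
  have "\<exists>u'\<in>carrier (alt_group m). \<exists>v'\<in>carrier (alt_group m). \<exists>w'\<in>carrier (alt_group m).
      s [^] j \<otimes> D u v w = D u' v' w' \<otimes> s [^] j"
    using assms(4-6)
  proof (induction j arbitrary: u v w)
    case 0 then show ?case
      by (intro bexI[of _ u] bexI[of _ v] bexI[of _ w]) (auto simp: alt_group_carrier D_closed)
  next
    case (Suc j)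
    \<comment> \<open>The hypothesis is taken at the rotated triple, because one factor
      \<open>s\<close> has already moved past \<open>D u v w\<close>.\<close>
    then obtain u' v' w' where *: "u' \<in> carrier (alt_group m)" "v' \<in> carrier (alt_group m)"
      "w' \<in> carrier (alt_group m)" "s [^] j \<otimes> D w u v = D u' v' w' \<otimes> s [^] j" by metis
    have "s [^] Suc j \<otimes> D u v w = (s [^] j \<otimes> D w u v) \<otimes> s"
      using Suc.prems s_closed by (simp add: m_assoc s_D alt_group_carrier D_closed)
    also have "\<dots> = D u' v' w' \<otimes> s [^] Suc j"
      using * s_closed by (simp add: m_assoc alt_group_carrier D_closed)
    finally show ?case using * by blast
  qed
  then obtain u' v' w' where *: "u' \<in> carrier (alt_group m)" "v' \<in> carrier (alt_group m)"
      "w' \<in> carrier (alt_group m)" "s [^] j \<otimes> D u v w = D u' v' w' \<otimes> s [^] j" by metis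
  have alt: "x \<circ> y \<circ> inv' x \<in> carrier (alt_group m)"
    if "x permutes {1..m}" "y \<in> carrier (alt_group m)" for x y
    using that permutes_imp_permutation[of "{1..m}" x] permutes_imp_permutation[of "{1..m}" y]
    by (auto simp: alt_group_carrier permutes_compose permutes_inv evenperm_comp evenperm_inv
        permutation_compose permutation_inverse simp del: o_apply)
  have cancel: "x \<circ> y \<circ> inv' x \<circ> x = x \<circ> y" if "x permutes {1..m}" for x y :: "nat \<Rightarrow> nat"
    using permutes_inv_o(2)[OF that] by (metis comp_assoc comp_id)
  have "(D a b c \<otimes> s [^] j) \<otimes> D u v w = (D a b c \<otimes> D u' v' w') \<otimes> s [^] j"
    using * assms s_closed by (simp add: m_assoc alt_group_carrier D_closed)
  also have "D a b c \<otimes> D u' v' w' =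
      D (a \<circ> u' \<circ> inv' a) (b \<circ> v' \<circ> inv' b) (c \<circ> w' \<circ> inv' c) \<otimes> D a b c"
    using * assms alt[OF assms(1) *(1)] alt[OF assms(2) *(2)] alt[OF assms(3) *(3)]
    by (simp add: alt_group_carrier D_mult cancel)
  finally show thesis
    using * assms alt s_closed
    by (intro that[of "a \<circ> u' \<circ> inv' a" "b \<circ> v' \<circ> inv' b" "c \<circ> w' \<circ> inv' c"])
      (auto simp: m_assoc alt_group_carrier D_closed)
qed

text \<open>Parities detect the intersection: if \<open>D u v w \<otimes> g h\<close> is trivial,
  then the coordinates of \<open>g h\<close> are inverse to even permutations and its shift
  vanishes, and by the last clause of \<open>g_form\<close> only the identity of \<open>H\<close>
  has this property.\<close>

lemma iso_to_semidirect_product_complement: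
  assumes "group H" and g: "g \<in> hom H K"
    and g_form: "\<And>h. h \<in> carrier H \<Longrightarrow> \<exists>a b c j. a permutes {1..m} \<and> b permutes {1..m} \<and>
      c permutes {1..m} \<and> j < (3::nat) \<and> g h = D a b c \<otimes> s [^] j \<and>
      (evenperm a \<and> evenperm b \<and> evenperm c \<and> j = 0 \<longrightarrow> h = \<one>\<^bsub>H\<^esub>)"
    and X: "X \<subseteq> {D u v w \<otimes> g h |u v w h. u \<in> carrier (alt_group m) \<and> v \<in> carrier (alt_group m) \<and>
      w \<in> carrier (alt_group m) \<and> h \<in> carrier H}"
    and N: "\<And>u v w. u \<in> carrier (alt_group m) \<Longrightarrow> v \<in> carrier (alt_group m) \<Longrightarrow>
      w \<in> carrier (alt_group m) \<Longrightarrow> D u v w \<in> generate K X"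
    and gH: "g ` carrier H \<subseteq> generate K X"
  shows "iso_to_semidirect_product (subgroup_generated K X)
    (alt_group m \<times>\<times> alt_group m \<times>\<times> alt_group m) H"
proof (rule iso_to_semidirect_product_generated[OF is_group _ \<open>group H\<close> _ g])
  let ?N = "alt_group m \<times>\<times> alt_group m \<times>\<times> alt_group m"
  let ?f = "\<lambda>(u, v, w). D u v w"
  show "group ?N"
    by (intro DirProd_group alt_group_is_group)
  show "?f \<in> hom ?N K"
    by (rule homI) (auto simp: alt_group_carrier alt_group_mult D_closed D_mult)
  show "?f ` carrier ?N \<subseteq> generate K X"
    using N by auto
  show "g ` carrier H \<subseteq> generate K X"
    by fact
  show "X \<subseteq> {?f a \<otimes> g h |a h. a \<in> carrier ?N \<and> h \<in> carrier H}"
    using X by fastforce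
  fix n h assume "n \<in> carrier ?N" and h: "h \<in> carrier H"
  then obtain u v w where n: "n = (u, v, w)" "u \<in> carrier (alt_group m)"
    "v \<in> carrier (alt_group m)" "w \<in> carrier (alt_group m)" by auto
  obtain a b c and j :: nat where abc: "a permutes {1..m}" "b permutes {1..m}" "c permutes {1..m}"
    "j < 3" "g h = D a b c \<otimes> s [^] j"
    "evenperm a \<and> evenperm b \<and> evenperm c \<and> j = 0 \<Longrightarrow> h = \<one>\<^bsub>H\<^esub>"
    using g_form[OF h] by metis
  show "\<exists>n'\<in>carrier ?N. g h \<otimes> ?f n = ?f n' \<otimes> g h"
  proof -
    obtain u' v' w' where "u' \<in> carrier (alt_group m)" "v' \<in> carrier (alt_group m)"
      "w' \<in> carrier (alt_group m)" "g h \<otimes> D u v w = D u' v' w' \<otimes> g h"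
      using D_conj[OF abc(1-3) n(2-4), of j] unfolding abc(5) by metis
    then show ?thesis
      using n(1) by (intro bexI[of _ "(u', v', w')"]) auto
  qed
  assume triv: "?f n \<otimes> g h = \<one>"
  have "D (u \<circ> a) (v \<circ> b) (w \<circ> c) \<otimes> s [^] j = \<one>"
    using triv abc n s_closed by (simp add: alt_group_carrier D_closed m_assoc flip: D_mult)
  then have ids: "u \<circ> a = id" "v \<circ> b = id" "w \<circ> c = id" "j = 0"
    using D_s_trivial[of "u \<circ> a" "v \<circ> b" "w \<circ> c" j] abc n
    by (simp_all add: alt_group_carrier permutes_compose)
  have even: "evenperm y" if "x \<circ> y = id" "x \<in> carrier (alt_group m)" "y permutes {1..m}" for x y
    using that evenperm_comp[of x y] permutes_imp_permutation[of "{1..m}"]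
    by (simp add: alt_group_carrier)
  have "h = \<one>\<^bsub>H\<^esub>"
    using even[OF ids(1) n(2) abc(1)] even[OF ids(2) n(3) abc(2)] even[OF ids(3) n(4) abc(3)] ids(4) abc(6)
    by blast
  moreover from this have "D u v w \<otimes> s [^] (0::nat) = \<one>"
    using triv n hom_one[OF g \<open>group H\<close> is_group] by (simp add: alt_group_carrier D_closed)
  then have "u = id \<and> v = id \<and> w = id"
    using D_s_trivial[of u v w 0] n by (simp add: alt_group_carrier)
  ultimately show "n = \<one>\<^bsub>?N\<^esub> \<and> h = \<one>\<^bsub>H\<^esub>"
    using n by (simp add: alt_group_one)
qed

lemma D_rotate:
  assumes "subgroup S K" "s \<in> S" "D a b c \<in> S"
    and abc: "a permutes {1..m}" "b permutes {1..m}" "c permutes {1..m}"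
  shows "D b c a \<in> S"  and "D c a b \<in> S"
proof -
  have rot: "D c a b \<in> S" if "D a b c \<in> S"
    and "a permutes {1..m}" "b permutes {1..m}" "c permutes {1..m}" for a b c
  proof -
    have "D c a b = s \<otimes> D a b c \<otimes> inv s"
      using that s_closed by (simp add: s_D D_closed m_assoc)
    then show ?thesis
      using that(1) assms(1,2) by (simp add: subgroup.m_closed subgroup.m_inv_closed)
  qed
  show "D c a b \<in> S" using rot assms(3) abc by blast
  then show "D b c a \<in> S" using rot abc by blast
qed

end

section \<open>The group generated by the shift and a pair of cycles meeting in one point\<close>

locale two_cycles = cyclic_wreath +
  fixes A B :: "nat set" and x y :: "nat \<Rightarrow> nat" and pt :: nat
  assumes AB: "A \<union> B = {1..m}" "A \<inter> B = {pt}"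
    and card_A: "card A \<ge> 2" and card_B: "card B \<ge> 2"
    and x_cyclic: "cyclic_on x A" and x_outside: "\<And>z. z \<notin> A \<Longrightarrow> x z = z"
    and y_cyclic: "cyclic_on y B" and y_outside: "\<And>z. z \<notin> B \<Longrightarrow> y z = z"
    and x_permutes: "x permutes {1..m}" and y_permutes: "y permutes {1..m}"
begin

definition "G = generate K {D x y id, s}"

lemma gens_closed: "{D x y id, s} \<subseteq> carrier K"
  using D_closed s_closed x_permutes y_permutes by (simp add: permutes_id)

lemma G_subgroup: "subgroup G K"
  unfolding G_def by (rule generate_is_subgroup[OF gens_closed])

lemma gens_in_G: "D x y id \<in> G" "s \<in> G"
  unfolding G_def by (auto intro: generate.incl)

lemmas G_mult = subgroup.m_closed[OF G_subgroup]
lemmas G_inv = subgroup.m_inv_closed[OF G_subgroup]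
lemmas G_rotate = D_rotate[OF G_subgroup gens_in_G(2)]

text \<open>The second and third coordinates of \<open>D (x ^^ i) (y ^^ i) id\<close> and \<open>D (y ^^ j) id (x ^^ j)\<close>
  commute, so their commutator lives in the first coordinate.\<close>

lemma commutator_in_G: "D (x ^^ i \<circ> y ^^ j \<circ> inv' (x ^^ i) \<circ> inv' (y ^^ j)) id id \<in> G"
proof -
  have px: "x ^^ i permutes {1..m}" for i by (rule permutes_funpow[OF x_permutes])
  have py: "y ^^ i permutes {1..m}" for i by (rule permutes_funpow[OF y_permutes])
  have xi: "D (x ^^ i) (y ^^ i) id \<in> G" for i
  proof (induction i)
    case 0 then show ?case
      using subgroup.one_closed[OF G_subgroup] by (simp flip: id_def add: D_id)
  next
    case (Suc i)
    have "D (x ^^ Suc i) (y ^^ Suc i) id = D x y id \<otimes> D (x ^^ i) (y ^^ i) id"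
      using px py x_permutes y_permutes by (simp add: D_mult permutes_id)
    with G_mult[OF gens_in_G(1) Suc] show ?case by (simp only:)
  qed
  have yj: "D (y ^^ j) id (x ^^ j) \<in> G"
    using G_rotate(1)[OF xi] px py by (simp add: permutes_id)
  have "D (x ^^ i) (y ^^ i) id \<otimes> D (y ^^ j) id (x ^^ j) \<otimes>
      inv (D (x ^^ i) (y ^^ i) id) \<otimes> inv (D (y ^^ j) id (x ^^ j)) =
      D (x ^^ i \<circ> y ^^ j \<circ> inv' (x ^^ i) \<circ> inv' (y ^^ j)) (y ^^ i \<circ> id \<circ> inv' (y ^^ i) \<circ> inv' id)
        (id \<circ> x ^^ j \<circ> inv' id \<circ> inv' (x ^^ j))"
    by (simp only: D_inv D_mult px py permutes_id permutes_inv permutes_compose)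
  also have "\<dots> = D (x ^^ i \<circ> y ^^ j \<circ> inv' (x ^^ i) \<circ> inv' (y ^^ j)) id id"
    using permutes_inv_o(1)[OF px] permutes_inv_o(1)[OF py] by (simp add: inv_id)
  finally show ?thesis
    using G_mult[OF G_mult[OF G_mult[OF xi[of i] yj] G_inv[OF xi[of i]]] G_inv[OF yj]] by (simp only:)
qed

text \<open>Since \<open>x\<close> is transitive on \<open>A\<close> and \<open>y\<close> on
  \<open>B\<close>, any two points \<open>a\<close> and \<open>b\<close> other than
  \<open>pt\<close> are \<open>(x ^^ i) pt\<close> and \<open>(y ^^ j) pt\<close>; this is why
  commutators of powers are considered. The commutator of these powers is the 3-cycle on
  \<open>pt\<close>, \<open>a\<close>, \<open>b\<close>, and rotation by \<open>s\<close> carries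
  the result from the first coordinate to the other two.\<close>

lemma alt_in_G:
  assumes uvw: "u \<in> carrier (alt_group m)" "v \<in> carrier (alt_group m)" "w \<in> carrier (alt_group m)"
  shows "D u v w \<in> G"
proof -
  let ?M = "{u. u permutes {1..m} \<and> D u id id \<in> G}"
  have M: "subgroup ?M (sym_group m)"
  proof (rule group.subgroupI[OF sym_group_is_group])
    show "?M \<noteq> {}"
      using subgroup.one_closed[OF G_subgroup] D_id by (auto intro!: exI[of _ id] permutes_id)
    fix u v assume uv: "u \<in> ?M" "v \<in> ?M"
    have "D (u \<circ> v) id id = D u id id \<otimes> D v id id"
      using uv by (simp add: D_mult permutes_id)
    then show "u \<otimes>\<^bsub>sym_group m\<^esub> v \<in> ?M"
      using uv G_mult by (simp add: sym_group_mult permutes_compose)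
  next
    fix u assume u: "u \<in> ?M"
    have "D (inv' u) id id = inv (D u id id)"
      using u by (simp add: D_inv permutes_id inv_id)
    then show "inv\<^bsub>sym_group m\<^esub> u \<in> ?M"
      using u G_inv by (simp add: sym_group_carrier permutes_inv)
  qed (auto simp: sym_group_carrier)
  have "carrier (alt_group m) \<subseteq> ?M"
  proof (rule alt_group_subset_of_cycles[OF M AB])
    show "A \<noteq> {pt}" "B \<noteq> {pt}"
      using card_A card_B by auto
    fix a b assume a: "a \<in> A - {pt}" and b: "b \<in> B - {pt}"
    have c: "pt \<in> A" "pt \<in> B" using AB(2) by auto
    obtain i where i: "a = (x ^^ i) pt"
      using x_cyclic c a unfolding cyclic_on_alldef orbit_altdef by blast
    obtain j where j: "b = (y ^^ j) pt"
      using y_cyclic c b unfolding cyclic_on_alldef orbit_altdef by blast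
    have "(x ^^ i) z = z" if "z \<notin> A" for z
      using x_outside[OF that] by (induction i) auto
    moreover have "(y ^^ j) z = z" if "z \<notin> B" for z
      using y_outside[OF that] by (induction j) auto
    ultimately have "x ^^ i \<circ> y ^^ j \<circ> inv' (x ^^ i) \<circ> inv' (y ^^ j) =
        cycle_of_list [pt, (x ^^ i) pt, (y ^^ j) pt]"
      using i j a b AB(2)
      by (intro commutator_of_permutations_meeting_in_one_point[OF
            permutes_funpow[OF x_permutes] permutes_funpow[OF y_permutes]]) blast+
    moreover have "x ^^ i \<circ> y ^^ j \<circ> inv' (x ^^ i) \<circ> inv' (y ^^ j) permutes {1..m}"
      by (intro permutes_compose permutes_inv permutes_funpow x_permutes y_permutes)
    ultimately show "cycle_of_list [pt, a, b] \<in> ?M"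
      using commutator_in_G[of i j] i j by (simp del: cycle_of_list.simps)
  qed
  then have *: "D u id id \<in> G" "u permutes {1..m}" if "u \<in> carrier (alt_group m)" for u
    using that by blast+
  have "D id v id \<in> G" "D id id w \<in> G"
    using G_rotate[OF *(1)] *(2) uvw by (simp_all add: permutes_id)
  then have "D u id id \<otimes> D id v id \<otimes> D id id w \<in> G"
    using G_mult *(1) uvw by simp
  then show ?thesis
    using uvw *(2) by (simp add: D_mult permutes_id permutes_compose)
qed

text \<open>\<open>E a b c\<close> applies the fixed transposition in the coordinates whose flag is set; these elements
  supply the complement.\<close>

definition flip :: "bool \<Rightarrow> nat \<Rightarrow> nat" where
  "flip a = (if a then transpose 1 2 else id)"

definition E :: "bool \<Rightarrow> bool \<Rightarrow> bool \<Rightarrow> 'a" where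
  "E a b c = D (flip a) (flip b) (flip c)"

text \<open>The points 1 and 2 must both exist: \<open>card A + card B = m + 1\<close> with both
  sizes at least 2 gives \<open>m \<ge> 3\<close>.\<close>

lemma flip_permutes: "flip a permutes {1..m}"
proof -
  have "finite A" "finite B"
    using AB(1) by (metis finite_Un finite_atLeastAtMost)+
  then have "card A + card B = m + 1"
    using card_Un_Int[of A B] AB by simp
  then show ?thesis
    using card_A card_B by (auto simp: flip_def intro!: permutes_swap_id permutes_id)
qed

lemma evenperm_flip: "evenperm (flip a) \<longleftrightarrow> \<not> a"
  by (simp add: flip_def evenperm_swap)

lemma flip_comp: "flip a \<circ> flip b = flip (a \<noteq> b)"
  by (auto simp: flip_def)

lemma E_closed: "E a b c \<in> carrier K"
  by (simp only: E_def D_closed flip_permutes)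

lemma E_mult: "E a b c \<otimes> E a' b' c' = E (a \<noteq> a') (b \<noteq> b') (c \<noteq> c')"
  by (simp only: E_def D_mult flip_permutes flip_comp)

lemma s_E: "s \<otimes> E a b c = E c a b \<otimes> s"
  by (simp only: E_def s_D flip_permutes)

lemma E_False: "E False False False = \<one>"
  by (simp add: E_def flip_def D_id)

text \<open>The flag vectors of even weight form a Klein four-group in which the third flag is
  determined by the first two; rotating the vector changes these two exactly as
  \<open>tetra_conj\<close> does.\<close>

lemma E_tetra: "tetra_relations K (\<lambda>a b. E a b (a \<noteq> b)) s"
proof -
  have "E a b (a \<noteq> b) \<otimes> E a' b' (a' \<noteq> b') = E (a \<noteq> a') (b \<noteq> b') ((a \<noteq> a') \<noteq> (b \<noteq> b'))" for a b a' b'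
    unfolding E_mult by (rule arg_cong[of _ _ "E _ _"]) blast
  moreover have "s \<otimes> E a b (a \<noteq> b) = E (a \<noteq> b) a ((a \<noteq> b) \<noteq> a) \<otimes> s" for a b
  proof -
    have "((a \<noteq> b) \<noteq> a) = b" by blast
    then show ?thesis unfolding s_E by simp
  qed
  ultimately show ?thesis
    unfolding tetra_relations_def using E_closed s_closed s_cubed by blast
qed

text \<open>Inserting the fixed involution twice in each odd coordinate splits the first generator
  into an even part and its parity vector.\<close>

lemma D_comp_flip: 
  "D x y id = D (x \<circ> flip (\<not> evenperm x)) (y \<circ> flip (\<not> evenperm y)) id \<otimes> E (\<not> evenperm x) (\<not> evenperm y) False"
  "x \<circ> flip (\<not> evenperm x) \<in> carrier (alt_group m)" "y \<circ> flip (\<not> evenperm y) \<in> carrier (alt_group m)"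
proof -
  have ff: "z \<circ> flip a \<circ> flip a = z" for z a
    by (simp add: comp_assoc flip_comp) (simp add: flip_def)
  show "D x y id = D (x \<circ> flip (\<not> evenperm x)) (y \<circ> flip (\<not> evenperm y)) id \<otimes> E (\<not> evenperm x) (\<not> evenperm y) False"
    unfolding E_def
    by (simp only: D_mult x_permutes y_permutes permutes_id flip_permutes permutes_compose ff)
      (simp add: flip_def)
  have "z \<circ> flip (\<not> evenperm z) \<in> carrier (alt_group m)" if "z permutes {1..m}" for z
    using that flip_permutes permutes_imp_permutation[of "{1..m}"]
    by (simp add: alt_group_carrier permutes_compose evenperm_comp evenperm_flip del: o_apply)
  then show "x \<circ> flip (\<not> evenperm x) \<in> carrier (alt_group m)" "y \<circ> flip (\<not> evenperm y) \<in> carrier (alt_group m)"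
    using x_permutes y_permutes by blast+
qed

text \<open>The even part of the first generator already lies in \<open>G\<close>, so dividing by it
  leaves the parity vector.\<close>

lemma E_parity_in_G: "E (\<not> evenperm x) (\<not> evenperm y) False \<in> G"
proof -
  let ?N = "D (x \<circ> flip (\<not> evenperm x)) (y \<circ> flip (\<not> evenperm y)) id"
  have N: "?N \<in> G"
    using D_comp_flip(2,3) by (intro alt_in_G) (auto simp: alt_group_carrier permutes_id)
  then have "inv ?N \<otimes> D x y id \<in> G"
    using G_mult[OF G_inv gens_in_G(1)] by blast
  moreover have "?N \<in> carrier K"
    using N subgroup.subset[OF G_subgroup] by blast
  ultimately show ?thesis
    using E_closed by (simp add: D_comp_flip(1) flip: m_assoc)
qed

lemma E_rotate: "E a b c \<in> G \<Longrightarrow> E b c a \<in> G" "E a b c \<in> G \<Longrightarrow> E c a b \<in> G"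
  unfolding E_def using G_rotate flip_permutes by blast+

section \<open>The complement determined by the parities of the two cycle lengths\<close>

lemma evenperm_x: "evenperm x \<longleftrightarrow> odd (card A)"
  using evenperm_cyclic_on[OF x_permutes _ x_cyclic] x_outside by simp

lemma evenperm_y: "evenperm y \<longleftrightarrow> odd (card B)"
  using evenperm_cyclic_on[OF y_permutes _ y_cyclic] y_outside by simp

text \<open>The flags of \<open>E a b c\<close> are the parities of its coordinates, which turns the
  triviality condition on the complement into a condition on flags. Both generators are products of
  the required form because \<open>D_comp_flip\<close> splits the first one and \<open>s\<close>
  lies in the complement.\<close>

lemma iso_if_gens_in:
  assumes "group H" and g: "g \<in> hom H K"
    and g_form: "\<And>h. h \<in> carrier H \<Longrightarrow> \<exists>a b c j. j < (3::nat) \<and> g h = E a b c \<otimes> s [^] j \<and>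
      (\<not> a \<and> \<not> b \<and> \<not> c \<and> j = 0 \<longrightarrow> h = \<one>\<^bsub>H\<^esub>)"
    and range: "E (\<not> evenperm x) (\<not> evenperm y) False \<in> g ` carrier H" "s \<in> g ` carrier H"
    and gH: "g ` carrier H \<subseteq> G"
  shows "iso_to_semidirect_product (subgroup_generated K {D x y id, s})
    (alt_group m \<times>\<times> alt_group m \<times>\<times> alt_group m) H"
proof (rule iso_to_semidirect_product_complement[OF \<open>group H\<close> g])
  fix h assume "h \<in> carrier H"
  then obtain a b c and j :: nat where "j < 3" "g h = E a b c \<otimes> s [^] j"
    "\<not> a \<and> \<not> b \<and> \<not> c \<and> j = 0 \<longrightarrow> h = \<one>\<^bsub>H\<^esub>"
    using g_form by metis
  then show "\<exists>a b c j. a permutes {1..m} \<and> b permutes {1..m} \<and> c permutes {1..m} \<and> j < (3::nat) \<and>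
      g h = D a b c \<otimes> s [^] j \<and> (evenperm a \<and> evenperm b \<and> evenperm c \<and> j = 0 \<longrightarrow> h = \<one>\<^bsub>H\<^esub>)"
    unfolding E_def using flip_permutes evenperm_flip by metis
next
  have id: "id \<in> carrier (alt_group m)" by (simp add: alt_group_carrier permutes_id)
  have "s = D id id id \<otimes> s" using s_closed by (simp add: D_id)
  then show "{D x y id, s} \<subseteq> {D u v w \<otimes> g h |u v w h. u \<in> carrier (alt_group m) \<and>
      v \<in> carrier (alt_group m) \<and> w \<in> carrier (alt_group m) \<and> h \<in> carrier H}"
    using range D_comp_flip id by auto blast+
qed (use alt_in_G gH in \<open>auto simp: G_def\<close>)

text \<open>Cycles of even length are odd permutations, so the parity vector is (1, 1, 0). Its
  rotations and zero are precisely the even-weight vectors of \<open>E_tetra\<close>.\<close>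

lemma iso_even_even:
  assumes "even (card A)" "even (card B)"
  shows "iso_to_semidirect_product (subgroup_generated K {D x y id, s})
    (alt_group m \<times>\<times> alt_group m \<times>\<times> alt_group m) (alt_group 4)"
proof -
  obtain g where g: "g \<in> hom (alt_group 4) K"
    "g ` carrier (alt_group 4) = {E a b (a \<noteq> b) \<otimes> s [^] j |a b j. j < (3::nat)}"
    "\<And>q. q \<in> carrier (alt_group 4) \<Longrightarrow>
      \<exists>a b j. j < (3::nat) \<and> g q = E a b (a \<noteq> b) \<otimes> s [^] j \<and> (\<not> a \<and> \<not> b \<and> j = 0 \<longrightarrow> q = id)"
    using alt_group_4_hom[OF E_tetra] by blast
  have TTF: "E True True False \<in> G"
    using E_parity_in_G assms by (simp add: evenperm_x evenperm_y)
  have "E a b (a \<noteq> b) \<in> G" for a b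
    using TTF E_rotate[OF TTF] subgroup.one_closed[OF G_subgroup] E_False by (cases a; cases b) auto
  moreover have "s [^] j \<in> G" for j :: nat
    using subgroup.m_closed[OF G_subgroup] subgroup.one_closed[OF G_subgroup] gens_in_G(2) by (induction j) auto
  ultimately have "g ` carrier (alt_group 4) \<subseteq> G"
    using G_mult unfolding g(2) by blast
  moreover have "E True True False \<in> g ` carrier (alt_group 4)"
    unfolding g(2) using E_closed by (force intro!: exI[of _ True] exI[of _ "0::nat"])
  moreover have "s \<in> g ` carrier (alt_group 4)"
    unfolding g(2) using s_closed
    by (force intro!: exI[of _ False] exI[of _ "1::nat"] simp: E_False)
  ultimately show ?thesis
    using g(3) assms
    by (intro iso_if_gens_in[OF alt_group_is_group g(1)]) (auto simp: evenperm_x evenperm_y alt_group_one, metis)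
qed

text \<open>Here both cycles are even permutations, the parity vector is zero, and the powers of
  \<open>s\<close> alone form the complement.\<close>

lemma iso_odd_odd:
  assumes "odd (card A)" "odd (card B)"
  shows "iso_to_semidirect_product (subgroup_generated K {D x y id, s})
    (alt_group m \<times>\<times> alt_group m \<times>\<times> alt_group m) (integer_mod_group 3)"
proof -
  let ?g = "\<lambda>z :: int. s [^] nat z"
  have carr: "carrier (integer_mod_group 3) = {0, 1, 2}"
    by (auto simp: carrier_integer_mod_group)
  have g: "?g \<in> hom (integer_mod_group 3) K"
  proof (rule homI)
    fix z z' assume "z \<in> carrier (integer_mod_group 3)" "z' \<in> carrier (integer_mod_group 3)"
    then have "nat ((z + z') mod 3) = (nat z + nat z') mod 3"
      by (auto simp: carr)
    then show "?g (z \<otimes>\<^bsub>integer_mod_group 3\<^esub> z') = ?g z \<otimes> ?g z'"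
      using s_closed s_cubed by (simp add: pow_mod_order nat_pow_mult)
  qed (simp add: s_closed)
  have "s [^] j \<in> G" for j :: nat
    using subgroup.m_closed[OF G_subgroup] subgroup.one_closed[OF G_subgroup] gens_in_G(2) by (induction j) auto
  then have "?g ` carrier (integer_mod_group 3) \<subseteq> G"
    by blast
  moreover have "\<one> \<in> ?g ` carrier (integer_mod_group 3)" "s \<in> ?g ` carrier (integer_mod_group 3)"
    using s_closed by (auto simp: carr)
  moreover have "\<exists>a b c j. j < (3::nat) \<and> ?g h = E a b c \<otimes> s [^] j \<and>
      (\<not> a \<and> \<not> b \<and> \<not> c \<and> j = 0 \<longrightarrow> h = \<one>\<^bsub>integer_mod_group 3\<^esub>)"
    if "h \<in> carrier (integer_mod_group 3)" for h
    using that s_closed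
    by (intro exI[of _ False] exI[of _ "nat h"]) (auto simp: carr E_False)
  ultimately show ?thesis
    using assms by (intro iso_if_gens_in[OF group_integer_mod_group g])
      (auto simp: evenperm_x evenperm_y E_False)
qed

text \<open>The parity vector has weight 1, so its rotations generate all eight flag vectors. They
  split into the even-weight vectors, which form \<open>A_4\<close> together with \<open>s\<close>,
  and the span of (1, 1, 1), which supplies the direct factor of order 2.\<close>

lemma iso_even_odd:
  assumes "even (card A) \<noteq> even (card B)"
  shows "iso_to_semidirect_product (subgroup_generated K {D x y id, s})
    (alt_group m \<times>\<times> alt_group m \<times>\<times> alt_group m) (alt_group 4 \<times>\<times> integer_mod_group 2)"
proof -
  obtain g where g: "g \<in> hom (alt_group 4) K"
    "g ` carrier (alt_group 4) = {E a b (a \<noteq> b) \<otimes> s [^] j |a b j. j < (3::nat)}"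
    "\<And>q. q \<in> carrier (alt_group 4) \<Longrightarrow>
      \<exists>a b j. j < (3::nat) \<and> g q = E a b (a \<noteq> b) \<otimes> s [^] j \<and> (\<not> a \<and> \<not> b \<and> j = 0 \<longrightarrow> q = id)"
    using alt_group_4_hom[OF E_tetra] by blast
  let ?H = "alt_group 4 \<times>\<times> integer_mod_group 2"
  let ?d = "\<lambda>z :: int. E (z = 1) (z = 1) (z = 1)"
  let ?g = "\<lambda>(q, z). g q \<otimes> ?d z"
  have carr: "carrier (integer_mod_group 2) = {0, 1}"
    by (auto simp: carrier_integer_mod_group)
  \<comment> \<open>A constant flag vector is invariant under rotation and therefore commutes with
    \<open>s\<close>.\<close>
  have d: "(E a b c \<otimes> s [^] j) \<otimes> E e e e = E (a \<noteq> e) (b \<noteq> e) (c \<noteq> e) \<otimes> s [^] j" for a b c e and j :: nat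
  proof -
    have "s [^] j \<otimes> E e e e = E e e e \<otimes> s [^] j"
    proof (induction j)
      case (Suc j)
      have "s [^] Suc j \<otimes> E e e e = (s [^] j \<otimes> E e e e) \<otimes> s"
        using s_closed E_closed by (simp add: m_assoc s_E)
      then show ?case
        unfolding Suc using s_closed E_closed by (simp add: m_assoc)
    qed (simp add: E_closed)
    then show ?thesis
      using E_closed s_closed by (simp add: m_assoc) (simp add: E_mult flip: m_assoc)
  qed
  have d_comm: "g q \<otimes> ?d z = ?d z \<otimes> g q" if "q \<in> carrier (alt_group 4)" for q z
  proof -
    obtain a b j where q: "g q = E a b (a \<noteq> b) \<otimes> s [^] (j::nat)"
      using g(3)[OF \<open>q \<in> _\<close>] by blast
    have "?d z \<otimes> g q = E (a \<noteq> (z = 1)) (b \<noteq> (z = 1)) ((a \<noteq> b) \<noteq> (z = 1)) \<otimes> s [^] j"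
      unfolding q using E_closed s_closed by (cases a; cases b; cases "z = 1") (simp_all add: E_mult flip: m_assoc)
    then show ?thesis unfolding q d ..
  qed
  have gq: "g q \<in> carrier K" if "q \<in> carrier (alt_group 4)" for q
    using g(1) that by (auto simp: hom_def)
  have hom: "?g \<in> hom ?H K"
  proof (rule homI)
    fix h h' assume "h \<in> carrier ?H" "h' \<in> carrier ?H"
    then obtain q z q' z' where h: "h = (q, z)" "h' = (q', z')" "q \<in> carrier (alt_group 4)"
      "q' \<in> carrier (alt_group 4)" "z \<in> {0, 1}" "z' \<in> {0, 1}"
      using carr by auto
    have "?d ((z + z') mod 2) = ?d z \<otimes> ?d z'"
      using h(5,6) by (auto simp: E_mult)
    then have "?g (h \<otimes>\<^bsub>?H\<^esub> h') = g q \<otimes> (g q' \<otimes> ?d z) \<otimes> ?d z'"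
      using h gq E_closed hom_mult[OF g(1) h(3,4)] by (simp add: m_assoc)
    also have "\<dots> = ?g h \<otimes> ?g h'"
      unfolding d_comm[OF h(4)] using h gq E_closed by (simp add: m_assoc)
    finally show "?g (h \<otimes>\<^bsub>?H\<^esub> h') = ?g h \<otimes> ?g h'" .
  qed (use gq E_closed in auto)
  have "E True False False \<in> G"
    using E_parity_in_G E_rotate(1)[of False True False] assms
    by (cases "even (card A)") (auto simp: evenperm_x evenperm_y)
  note E1 = this E_rotate[OF this]
  have E_in: "E a b c \<in> G" for a b c
  proof -
    have "E a b c = E a False False \<otimes> E False b False \<otimes> E False False c"
      by (simp add: E_mult)
    moreover have "E a False False \<in> G" "E False b False \<in> G" "E False False c \<in> G"
      using E1 subgroup.one_closed[OF G_subgroup] E_False by (cases a; cases b; cases c; simp)+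
    ultimately show ?thesis using G_mult by simp
  qed
  moreover have "s [^] j \<in> G" for j :: nat
    using subgroup.m_closed[OF G_subgroup] subgroup.one_closed[OF G_subgroup] gens_in_G(2) by (induction j) auto
  ultimately have "g ` carrier (alt_group 4) \<subseteq> G"
    using G_mult unfolding g(2) by blast
  then have gH: "?g ` carrier ?H \<subseteq> G"
    using G_mult E_in by auto
  have Eg: "E (\<not> evenperm x) (\<not> evenperm y) False \<in> ?g ` carrier ?H"
  proof -
    let ?a = "evenperm x" and ?b = "evenperm y"
    have ab: "?a \<noteq> ?b" using assms by (auto simp: evenperm_x evenperm_y)
    \<comment> \<open>Exactly one of the two cycles is even, so \<open>?a \<noteq> ?b\<close> is
      true, and adding (1, 1, 1) to this even-weight vector complements the first two flags and
      clears the third.\<close>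
    have "E ?a ?b (?a \<noteq> ?b) \<otimes> s [^] (0::nat) \<in> g ` carrier (alt_group 4)"
      unfolding g(2) using zero_less_numeral by blast
    then obtain q where q: "q \<in> carrier (alt_group 4)" "g q = E ?a ?b (?a \<noteq> ?b) \<otimes> s [^] (0::nat)"
      by auto
    have eq: "E (\<not> evenperm x) (\<not> evenperm y) False = ?g (q, 1)"
      using q(2) ab E_closed by (simp add: E_mult)
    have mem: "(q, 1) \<in> carrier ?H" using q(1) carr by simp
    show ?thesis using eq mem by (intro image_eqI[where f = ?g])
  qed
  have sg: "s \<in> ?g ` carrier ?H"
  proof -
    have "E False False (False \<noteq> False) \<otimes> s [^] (1::nat) \<in> g ` carrier (alt_group 4)"
      unfolding g(2) by (intro CollectI exI[of _ False] exI[of _ "1::nat"] conjI refl) simp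
    then obtain q where q: "q \<in> carrier (alt_group 4)" "g q = s"
      using s_closed E_False by auto
    have eq: "s = ?g (q, 0)" using q s_closed E_False by simp
    have mem: "(q, 0) \<in> carrier ?H" using q(1) carr by simp
    show ?thesis using eq mem by (intro image_eqI[where f = ?g])
  qed
  have form: "\<exists>a b c j. j < (3::nat) \<and> ?g h = E a b c \<otimes> s [^] j \<and>
      (\<not> a \<and> \<not> b \<and> \<not> c \<and> j = 0 \<longrightarrow> h = \<one>\<^bsub>?H\<^esub>)" if hH: "h \<in> carrier ?H" for h
  proof -
    obtain q z where h: "h = (q, z)" "q \<in> carrier (alt_group 4)" "z \<in> {0, 1}"
      using hH carr by auto
    obtain a b j where q: "j < (3::nat)" "g q = E a b (a \<noteq> b) \<otimes> s [^] j"
        "\<not> a \<and> \<not> b \<and> j = 0 \<longrightarrow> q = id"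
      using g(3)[OF h(2)] by blast
    have "?g h = E (a \<noteq> (z = 1)) (b \<noteq> (z = 1)) ((a \<noteq> b) \<noteq> (z = 1)) \<otimes> s [^] j"
      using h q(2) d by simp
    \<comment> \<open>If all three flags vanish, then \<open>a\<close> and \<open>b\<close> both
      equal \<open>z = 1\<close>; hence \<open>a \<noteq> b\<close> is false, and the third flag
      forces \<open>z = 0\<close>.\<close>
    moreover have "h = \<one>\<^bsub>?H\<^esub>"
      if "\<not> (a \<noteq> (z = 1)) \<and> \<not> (b \<noteq> (z = 1)) \<and> \<not> ((a \<noteq> b) \<noteq> (z = 1)) \<and> j = 0"
      using that q(3) h by (auto simp: alt_group_one)
    ultimately show ?thesis using q(1) by blast
  qed
  show ?thesis
    by (rule iso_if_gens_in[where g = ?g])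
      (rule DirProd_group alt_group_is_group group_integer_mod_group hom form Eg sg gH | assumption)+
qed

end

subsection \<open>Permutations of three sheets\<close>

text \<open>\<open>co (k, j)\<close> is the label of the \<open>k\<close>-th point of the \<open>j\<close>-th sheet.\<close>

locale sheets =
  fixes n m :: nat and co :: "nat \<times> nat \<Rightarrow> nat" and \<sigma>1 :: "nat \<Rightarrow> nat"
  assumes m_pos: "m > 0"
    and co: "bij_betw co ({1..m} \<times> {..<3}) {1..n}"
    and \<sigma>1_permutes: "\<sigma>1 permutes {1..n}"
    and \<sigma>1_co: "\<And>k j. k \<in> {1..m} \<Longrightarrow> j < 3 \<Longrightarrow> \<sigma>1 (co (k, j)) = co (k, Suc j mod 3)"
begin

definition sheetwise :: "(nat \<Rightarrow> nat) \<Rightarrow> (nat \<Rightarrow> nat) \<Rightarrow> (nat \<Rightarrow> nat) \<Rightarrow> nat \<Rightarrow> nat" where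
  "sheetwise a b c i = (if i \<in> {1..n} then
     (case inv_into ({1..m} \<times> {..<3}) co i of (k, j) \<Rightarrow> co (([a, b, c] ! j) k, j)) else i)"

lemma co_in: "k \<in> {1..m} \<Longrightarrow> j < 3 \<Longrightarrow> co (k, j) \<in> {1..n}"
  using bij_betwE[OF co] by blast

lemma co_eq: "co (k, j) = co (k', j') \<longleftrightarrow> k = k' \<and> j = j'"
  if "k \<in> {1..m}" "j < 3" "k' \<in> {1..m}" "j' < 3"
  using bij_betw_imp_inj_on[OF co] that by (auto dest: inj_onD)

lemma sheetwise_co:
  "k \<in> {1..m} \<Longrightarrow> j < 3 \<Longrightarrow> sheetwise a b c (co (k, j)) = co (([a, b, c] ! j) k, j)"
  using co_in bij_betw_inv_into_left[OF co, of "(k, j)"] by (simp add: sheetwise_def)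

lemma sheetwise_outside: "i \<notin> {1..n} \<Longrightarrow> sheetwise a b c i = i"
  by (simp add: sheetwise_def del: atLeastAtMost_iff)

lemma eqI:
  assumes "\<And>i. i \<notin> {1..n} \<Longrightarrow> f i = g i"
    and "\<And>k j. k \<in> {1..m} \<Longrightarrow> j < 3 \<Longrightarrow> f (co (k, j)) = g (co (k, j))"
  shows "f = g"
proof
  fix i show "f i = g i"
  proof (cases "i \<in> {1..n}")
    case True
    then obtain k j where "k \<in> {1..m}" "j \<in> {..<3}" "i = co (k, j)"
      using bij_betw_imp_surj_on[OF co] by blast
    then show ?thesis using assms(2) by simp
  qed (rule assms(1))
qed

lemma nth_permutes:
  assumes "a permutes {1..m}" "b permutes {1..m}" "c permutes {1..m}" "j < 3"
  shows "[a, b, c] ! j permutes {1..m}"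
  using assms by (auto simp: less_Suc_eq numeral_3_eq_3)

lemma nth_in:
  assumes "a permutes {1..m}" "b permutes {1..m}" "c permutes {1..m}" "j < 3" "k \<in> {1..m}"
  shows "([a, b, c] ! j) k \<in> {1..m}"
  using permutes_in_image[OF nth_permutes[OF assms(1-4)]] assms(5) by (simp only:)

lemma sheetwise_comp:
  assumes "a permutes {1..m}" "b permutes {1..m}" "c permutes {1..m}"
    and "a' permutes {1..m}" "b' permutes {1..m}" "c' permutes {1..m}"
  shows "sheetwise a b c \<circ> sheetwise a' b' c' = sheetwise (a \<circ> a') (b \<circ> b') (c \<circ> c')"
proof (rule eqI)
  fix k j assume kj: "k \<in> {1..m}" "j < (3::nat)"
  then have "([a', b', c'] ! j) k \<in> {1..m}"
    using nth_in[OF assms(4-6)] by blast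
  moreover have "[a \<circ> a', b \<circ> b', c \<circ> c'] ! j = ([a, b, c] ! j) \<circ> ([a', b', c'] ! j)"
    using kj(2) by (auto simp: less_Suc_eq numeral_3_eq_3)
  ultimately show "(sheetwise a b c \<circ> sheetwise a' b' c') (co (k, j)) =
      sheetwise (a \<circ> a') (b \<circ> b') (c \<circ> c') (co (k, j))"
    using kj by (simp add: sheetwise_co del: atLeastAtMost_iff)
qed (simp add: sheetwise_outside del: atLeastAtMost_iff)

lemma sheetwise_id: "sheetwise id id id = id"
proof (rule eqI)
  fix k j assume kj: "k \<in> {1..m}" "j < (3::nat)"
  moreover have "[id, id, id] ! j = (id :: nat \<Rightarrow> nat)"
    using kj(2) by (auto simp: less_Suc_eq numeral_3_eq_3)
  ultimately show "sheetwise id id id (co (k, j)) = id (co (k, j))"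
    by (simp add: sheetwise_co del: atLeastAtMost_iff)
qed (simp add: sheetwise_outside del: atLeastAtMost_iff)

lemma sheetwise_permutes:
  assumes "a permutes {1..m}" "b permutes {1..m}" "c permutes {1..m}"
  shows "sheetwise a b c permutes {1..n}"
proof -
  have "sheetwise a b c \<circ> sheetwise (inv' a) (inv' b) (inv' c) = id"
    "sheetwise (inv' a) (inv' b) (inv' c) \<circ> sheetwise a b c = id"
    using assms by (simp_all only: sheetwise_comp permutes_inv permutes_inv_o sheetwise_id)
  then have "bij (sheetwise a b c)"
    using o_bij by blast
  then show ?thesis
    using sheetwise_outside unfolding permutes_def bij_iff by blast
qed

lemma \<sigma>1_funpow_co: "k \<in> {1..m} \<Longrightarrow> j < 3 \<Longrightarrow> (\<sigma>1 ^^ i) (co (k, j)) = co (k, (i + j) mod 3)"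
proof (induction i)
  case (Suc i)
  then have "(\<sigma>1 ^^ Suc i) (co (k, j)) = \<sigma>1 (co (k, (i + j) mod 3))"
    by simp
  also have "\<dots> = co (k, Suc (i + j) mod 3)"
    using \<sigma>1_co[OF Suc.prems(1), of "(i + j) mod 3"] mod_Suc_eq[of "i + j" 3]
    by (simp only: mod_less_divisor zero_less_numeral)
  finally show ?case by simp
qed simp

lemma sym_group_pow: "f [^]\<^bsub>sym_group n\<^esub> (i::nat) = f ^^ i"
proof (induction i)
  case (Suc i)
  have "f [^]\<^bsub>sym_group n\<^esub> Suc i = f ^^ i \<circ> f"
    using Suc by (simp add: nat_pow_def sym_group_mult)
  then show ?case by (metis funpow_Suc_right)
qed (simp add: nat_pow_def sym_group_one)

lemma cyclic_wreath: "cyclic_wreath (sym_group n) m sheetwise \<sigma>1"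
proof -
  interpret group "sym_group n" by (rule sym_group_is_group)
  show ?thesis
  proof unfold_locales
    have "\<sigma>1 ^^ 3 = id"
    proof (rule eqI)
      fix i assume "i \<notin> {1..n}"
      then show "(\<sigma>1 ^^ 3) i = id i"
        using permutes_not_in[OF permutes_funpow[OF \<sigma>1_permutes]] by simp
    qed (simp only: \<sigma>1_funpow_co mod_add_self1 mod_less id_apply)
    then show "\<sigma>1 [^]\<^bsub>sym_group n\<^esub> (3::nat) = \<one>\<^bsub>sym_group n\<^esub>"
      by (simp only: sym_group_pow sym_group_one)
  next
    fix a b c :: "nat \<Rightarrow> nat"
    assume abc: "a permutes {1..m}" "b permutes {1..m}" "c permutes {1..m}"
    have "\<sigma>1 \<circ> sheetwise a b c = sheetwise c a b \<circ> \<sigma>1"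
    proof (rule eqI)
      fix k j assume kj: "k \<in> {1..m}" "j < (3::nat)"
      \<comment> \<open>The shift takes sheet \<open>j\<close> to its successor, so the permutation
        acting on sheet \<open>j\<close> before the shift has to act on the next sheet after
        it.\<close>
      have "[c, a, b] ! (Suc j mod 3) = [a, b, c] ! j"
      proof -
        have "j = 0 \<or> j = 1 \<or> j = 2" using kj(2) by linarith
        then show ?thesis by (elim disjE) simp_all
      qed
      moreover have "([a, b, c] ! j) k \<in> {1..m}"
        using nth_in[OF abc kj(2,1)] .
      ultimately show "(\<sigma>1 \<circ> sheetwise a b c) (co (k, j)) = (sheetwise c a b \<circ> \<sigma>1) (co (k, j))"
        using kj \<sigma>1_co[of "([a, b, c] ! j) k" j] sheetwise_co[of k "Suc j mod 3" c a b]
        by (simp only: o_apply sheetwise_co \<sigma>1_co mod_less_divisor zero_less_numeral)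
    next
      fix i assume "i \<notin> {1..n}"
      then show "(\<sigma>1 \<circ> sheetwise a b c) i = (sheetwise c a b \<circ> \<sigma>1) i"
        using permutes_not_in[OF \<sigma>1_permutes] by (simp add: sheetwise_outside del: atLeastAtMost_iff)
    qed
    then show "\<sigma>1 \<otimes>\<^bsub>sym_group n\<^esub> sheetwise a b c = sheetwise c a b \<otimes>\<^bsub>sym_group n\<^esub> \<sigma>1"
      by (simp only: sym_group_mult)
  next
    fix a b c :: "nat \<Rightarrow> nat" and j :: nat
    assume abc: "a permutes {1..m}" "b permutes {1..m}" "c permutes {1..m}" and j: "j < 3"
      and "sheetwise a b c \<otimes>\<^bsub>sym_group n\<^esub> \<sigma>1 [^]\<^bsub>sym_group n\<^esub> j = \<one>\<^bsub>sym_group n\<^esub>"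
    then have eq: "sheetwise a b c ((\<sigma>1 ^^ j) i) = i" for i
      by (simp add: sym_group_pow sym_group_mult sym_group_one fun_eq_iff)
    have img: "([a, b, c] ! i) k \<in> {1..m}" if "i < 3" "k \<in> {1..m}" for i k
      using nth_in[OF abc that] .
    have "1 \<in> {1..m}"
      using m_pos by simp
    then have "co (([a, b, c] ! j) 1, j) = co (1, 0)"
      using eq[of "co (1, 0)"] \<sigma>1_funpow_co[of 1 0 j] sheetwise_co[of 1 j a b c] j
      by (simp only: add_0_right mod_less zero_less_numeral)
    then have j0: "j = 0"
      using co_eq[OF img[OF j \<open>1 \<in> {1..m}\<close>] j \<open>1 \<in> {1..m}\<close>, of 0] by (simp only: zero_less_numeral)
    have id: "([a, b, c] ! i) k = k" if "i < 3" "k \<in> {1..m}" for i k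
      using eq[of "co (k, i)"] sheetwise_co[OF that(2,1), of a b c] co_eq[OF img[OF that] that(1,2,1)]
      by (simp only: j0 funpow_0)
    have all: "f = id" if "f permutes {1..m}" "\<And>k. k \<in> {1..m} \<Longrightarrow> f k = k" for f
    proof
      fix k show "f k = id k"
        unfolding id_apply using that(2) permutes_not_in[OF that(1)] by blast
    qed
    have "a = id"
      using id[of 0] by (intro all abc(1)) simp
    moreover have "b = id"
      using id[of 1] by (intro all abc(2)) simp
    moreover have "c = id"
      using id[of 2] by (intro all abc(3)) simp
    ultimately show "a = id \<and> b = id \<and> c = id \<and> j = 0"
      using j0 by blast
  qed (simp_all only: sym_group_mult sheetwise_comp sym_group_carrier sheetwise_permutes \<sigma>1_permutes)
qed

end

subsection \<open>Trees with two hubs\<close>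

text \<open>The iterates of \<open>e\<close> are distinct up to the first return time and exhaust
  the orbit, so that time equals the size 3 of \<open>S\<close>.\<close>

lemma cyclic_on_card_3:
  assumes "cyclic_on f S" "card S = 3" "e \<in> S"
  shows "S = (\<lambda>i. (f ^^ i) e) ` {..<3}" "inj_on (\<lambda>i. (f ^^ i) e) {..<3}" "(f ^^ 3) e = e"
proof -
  have e: "e \<in> orbit f e" and S: "S = orbit f e"
    using assms(1,3) unfolding cyclic_on_alldef by blast+
  let ?d = "funpow_dist1 f e e"
  have inj: "inj_on (\<lambda>i. (f ^^ i) e) {0..<?d}"
    by (rule inj_on_funpow_dist1[OF e])
  have im: "S = (\<lambda>i. (f ^^ i) e) ` {0..<?d}"
    using orbit_conv_funpow_dist1[OF e] S by simp
  have "?d = 3"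
    using card_image[OF inj] im assms(2) by simp
  then show "S = (\<lambda>i. (f ^^ i) e) ` {..<3}" "inj_on (\<lambda>i. (f ^^ i) e) {..<3}" "(f ^^ 3) e = e"
    using im inj funpow_dist1_prop[OF e] by (simp_all only: atLeast0LessThan)
qed

text \<open>Peels one entry off a degree multiset together with a vertex carrying it. Applied twice,
  it yields the two hubs as distinct vertices.\<close>

lemma image_mset_mset_set_eq_add_mset:
  assumes "finite S" "image_mset f (mset_set S) = add_mset a M"
  obtains x where "x \<in> S" "f x = a" "image_mset f (mset_set (S - {x})) = M"
proof -
  have "a \<in># image_mset f (mset_set S)"
    using assms(2) by simp
  then obtain x where x: "x \<in> S" "f x = a"
    using assms(1) by auto
  then have "mset_set S = add_mset x (mset_set (S - {x}))"
    using assms(1) by (metis finite_Diff insert_Diff mset_set.insert Diff_iff insertI1)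
  then show thesis
    using that x assms(2) by simp
qed

lemma image_mset_mset_set_eq_replicate:
  assumes "finite S" "image_mset f (mset_set S) = replicate_mset k a"
  shows "card S = k" "\<And>x. x \<in> S \<Longrightarrow> f x = a"
proof -
  show "card S = k"
    using arg_cong[OF assms(2), of size] by simp
  fix x assume "x \<in> S"
  then have "f x \<in># replicate_mset k a"
    using assms by (metis finite_set_mset_mset_set imageI set_image_mset)
  then show "f x = a"
    by (simp split: if_splits)
qed

context sheets
begin

lemma iso_monodromy:
  assumes \<sigma>0: "\<sigma>0 permutes {1..n}"
    "\<And>k. k \<in> {1..m} \<Longrightarrow> \<sigma>0 (co (k, 0)) = co (x k, 0)"
    "\<And>k. k \<in> {1..m} \<Longrightarrow> \<sigma>0 (co (k, 1)) = co (y k, 1)"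
    "\<And>k. k \<in> {1..m} \<Longrightarrow> \<sigma>0 (co (k, 2)) = co (k, 2)"
    and two_cycles: "two_cycles_axioms m A B x y pt"
  shows "even (card A) \<and> even (card B) \<longrightarrow>
      iso_to_semidirect_product (subgroup_generated (sym_group n) {\<sigma>0, \<sigma>1})
        (alt_group m \<times>\<times> alt_group m \<times>\<times> alt_group m) (alt_group 4)"
    and "odd (card A) \<and> odd (card B) \<longrightarrow>
      iso_to_semidirect_product (subgroup_generated (sym_group n) {\<sigma>0, \<sigma>1})
        (alt_group m \<times>\<times> alt_group m \<times>\<times> alt_group m) (integer_mod_group 3)"
    and "even (card A) \<noteq> even (card B) \<longrightarrow>
      iso_to_semidirect_product (subgroup_generated (sym_group n) {\<sigma>0, \<sigma>1})
        (alt_group m \<times>\<times> alt_group m \<times>\<times> alt_group m) (alt_group 4 \<times>\<times> integer_mod_group 2)"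
proof -
  interpret two_cycles "sym_group n" m sheetwise \<sigma>1 A B x y pt
    using cyclic_wreath two_cycles by (rule two_cycles.intro)
  have "\<sigma>0 = sheetwise x y id"
  proof (rule eqI)
    fix k j assume kj: "k \<in> {1..m}" "j < (3::nat)"
    then consider "j = 0" | "j = 1" | "j = 2" by linarith
    then show "\<sigma>0 (co (k, j)) = sheetwise x y id (co (k, j))"
      using \<sigma>0(2-4)[OF kj(1)] sheetwise_co[OF kj, of x y id] by cases simp_all
  qed (use permutes_not_in[OF \<sigma>0(1)] sheetwise_outside in metis)
  with iso_even_even iso_odd_odd iso_even_odd
  show "even (card A) \<and> even (card B) \<longrightarrow>
      iso_to_semidirect_product (subgroup_generated (sym_group n) {\<sigma>0, \<sigma>1})
        (alt_group m \<times>\<times> alt_group m \<times>\<times> alt_group m) (alt_group 4)"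
    and "odd (card A) \<and> odd (card B) \<longrightarrow>
      iso_to_semidirect_product (subgroup_generated (sym_group n) {\<sigma>0, \<sigma>1})
        (alt_group m \<times>\<times> alt_group m \<times>\<times> alt_group m) (integer_mod_group 3)"
    and "even (card A) \<noteq> even (card B) \<longrightarrow>
      iso_to_semidirect_product (subgroup_generated (sym_group n) {\<sigma>0, \<sigma>1})
        (alt_group m \<times>\<times> alt_group m \<times>\<times> alt_group m) (alt_group 4 \<times>\<times> integer_mod_group 2)"
    by blast+
qed

end

text \<open>All hypotheses are symmetric in \<open>X\<close> and \<open>Y\<close>, so the locale can
  be interpreted with the hubs in either order, as the orientation at the common white vertex
  demands.\<close>

locale two_hubs =
  fixes T :: "('b, 'w) bicolored_graph" and X Y :: 'b
  assumes tree: "bicolored_plane_tree T"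
    and hubs: "X \<in> black T" "Y \<in> black T" "X \<noteq> Y"
    and hub_degree: "card (black_star T X) \<ge> 2" "card (black_star T Y) \<ge> 2"
    and leaf: "\<And>b. b \<in> black T \<Longrightarrow> b \<noteq> X \<Longrightarrow> b \<noteq> Y \<Longrightarrow> card (black_star T b) = 1"
    and white_degree: "\<And>w. w \<in> white T \<Longrightarrow> card (white_star T w) = 3"
    and card_white: "card (black_star T X) + card (black_star T Y) = card (white T) + 1"
begin

lemma finite_white: "finite (white T)"
  and edges_subset: "edges T \<subseteq> black T \<times> white T"
  and connected: "graph_connected T"
  and black_cyclic: "b \<in> black T \<Longrightarrow> cyclic_on (black_rot T) (black_star T b)"
  and white_cyclic: "w \<in> white T \<Longrightarrow> cyclic_on (white_rot T) (white_star T w)"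
  using tree by (simp_all add: bicolored_plane_tree_def)

definition "NX = {w. (X, w) \<in> edges T}"
definition "NY = {w. (Y, w) \<in> edges T}"

lemma star_eq: "black_star T X = Pair X ` NX" "black_star T Y = Pair Y ` NY"
  by (auto simp: black_star_def NX_def NY_def)

lemma card_N: "card (black_star T X) = card NX" "card (black_star T Y) = card NY"
  unfolding star_eq by (simp_all add: card_image inj_on_def)

lemma leaf_rot:
  assumes "e \<in> edges T" "fst e \<noteq> X" "fst e \<noteq> Y"
  shows "black_rot T e = e"
proof -
  have b: "fst e \<in> black T"
    using assms(1) edges_subset by auto
  have e: "e \<in> black_star T (fst e)"
    using assms(1) by (simp add: black_star_def)
  then have "black_star T (fst e) = {e}"
    using leaf[OF b assms(2,3)] by (metis card_1_singletonE singletonD)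
  then show ?thesis
    using cyclic_on_inI[OF black_cyclic[OF b] e] by simp
qed

text \<open>A white vertex away from both hubs would form a connected component with its three leaves.\<close>

lemma white_near_hub: "NX \<union> NY = white T"
proof
  show "NX \<union> NY \<subseteq> white T"
    using edges_subset by (auto simp: NX_def NY_def)
  show "white T \<subseteq> NX \<union> NY"
  proof
    fix w assume w: "w \<in> white T"
    show "w \<in> NX \<union> NY"
    proof (rule ccontr)
      assume far: "w \<notin> NX \<union> NY"
      let ?Z = "insert (Inr w) {Inl b |b. (b, w) \<in> edges T}"
      have closed: "v \<in> ?Z" if u: "u \<in> ?Z" and uv: "(u, v) \<in> adjacency T" for u v
      proof (cases "u = Inr w")
        case True
        then show ?thesis using uv by (auto simp: adjacency_def)
      next
        case False
        then obtain b where b: "u = Inl b" "(b, w) \<in> edges T"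
          using u by auto
        then obtain w' where w': "v = Inr w'" "(b, w') \<in> edges T"
          using uv by (auto simp: adjacency_def)
        have "b \<in> black T" "b \<noteq> X" "b \<noteq> Y"
          using b(2) far edges_subset by (auto simp: NX_def NY_def)
        then have "card (black_star T b) = 1"
          using leaf by blast
        moreover have "(b, w) \<in> black_star T b" "(b, w') \<in> black_star T b"
          using b w' by (auto simp: black_star_def)
        ultimately have "(b, w) = (b, w')"
          by (metis card_1_singletonE singletonD)
        then show ?thesis using w' by simp
      qed
      have "Inr w \<in> vertices T" "Inl X \<in> vertices T"
        using w hubs(1) by (auto simp: vertices_def)
      then have "(Inr w, Inl X) \<in> (adjacency T)\<^sup>*"
        using connected unfolding graph_connected_def by blast
      then have "Inl X \<in> ?Z"
        by (induction rule: rtrancl_induct) (use closed in blast)+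
      then show False
        using far by (auto simp: NX_def)
    qed
  qed
qed

text \<open>Inclusion-exclusion: the two neighbourhoods cover the white vertices, and by
  \<open>card_white\<close> their sizes add up to one more than the number of white
  vertices.\<close>

lemma central: obtains w where "NX \<inter> NY = {w}"
proof -
  have "finite NX" "finite NY"
    using finite_white white_near_hub by (metis finite_Un)+
  then have "card (NX \<inter> NY) = 1"
    using card_Un_Int[of NX NY] card_white white_near_hub by (simp add: card_N)
  then show thesis
    using that by (rule card_1_singletonE)
qed

text \<open>An edge at the hub \<open>Z\<close> is determined by its white end, so the rotation
  around \<open>Z\<close> becomes a cycle on the indices of the white neighbours, extended by fixed
  points. It is used for both hubs to obtain the two cycles.\<close>

lemma hub_cycle:
  assumes Z: "Z \<in> black T" and \<omega>: "bij_betw \<omega> {1..m} (white T)"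
  obtains x where "x permutes {1..m}" and "cyclic_on x {k \<in> {1..m}. (Z, \<omega> k) \<in> edges T}"
    and "\<And>k. k \<notin> {k \<in> {1..m}. (Z, \<omega> k) \<in> edges T} \<Longrightarrow> x k = k"
    and "\<And>k. k \<in> {k \<in> {1..m}. (Z, \<omega> k) \<in> edges T} \<Longrightarrow> black_rot T (Z, \<omega> k) = (Z, \<omega> (x k))"
    and "card {k \<in> {1..m}. (Z, \<omega> k) \<in> edges T} = card (black_star T Z)"
proof -
  let ?A = "{k \<in> {1..m}. (Z, \<omega> k) \<in> edges T}"
  let ?h = "\<lambda>e. inv_into {1..m} \<omega> (snd e)"
  define x where "x k = (if k \<in> ?A then ?h (black_rot T (Z, \<omega> k)) else k)" for k
  have star: "black_star T Z = (\<lambda>k. (Z, \<omega> k)) ` ?A"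
  proof
    show "black_star T Z \<subseteq> (\<lambda>k. (Z, \<omega> k)) ` ?A"
    proof
      fix e assume "e \<in> black_star T Z"
      then have e: "e \<in> edges T" "e = (Z, snd e)"
        by (auto simp: black_star_def)
      then have "snd e \<in> white T"
        using edges_subset by (metis SigmaD2 subsetD)
      then obtain k where "k \<in> {1..m}" "snd e = \<omega> k"
        using bij_betw_imp_surj_on[OF \<omega>] by blast
      then show "e \<in> (\<lambda>k. (Z, \<omega> k)) ` ?A"
        using e by (intro image_eqI[of _ _ k]) (simp_all add: e(2)[symmetric])
    qed
  qed (auto simp: black_star_def)
  have inj: "inj_on (\<lambda>k. (Z, \<omega> k)) ?A"
    using bij_betw_imp_inj_on[OF \<omega>] by (auto simp: inj_on_def)
  have h: "?h (Z, \<omega> k) = k" if "k \<in> ?A" for k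
    using bij_betw_inv_into_left[OF \<omega>, of k] that by simp
  have rot: "black_rot T (Z, \<omega> k) \<in> (\<lambda>k. (Z, \<omega> k)) ` ?A" if "k \<in> ?A" for k
    using cyclic_on_inI[OF black_cyclic[OF Z], of "(Z, \<omega> k)"] that unfolding star by blast
  have x: "black_rot T (Z, \<omega> k) = (Z, \<omega> (x k))" if k: "k \<in> ?A" for k
  proof -
    obtain k' where k': "k' \<in> ?A" "black_rot T (Z, \<omega> k) = (Z, \<omega> k')"
      using rot[OF k] by blast
    then have "x k = k'"
      using h[OF k'(1)] k by (simp only: x_def if_True)
    then show ?thesis using k'(2) by simp
  qed
  have "(\<lambda>k. ?h (Z, \<omega> k)) ` ?A = (\<lambda>k. k) ` ?A"
    by (rule image_cong[OF refl]) (rule h)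
  then have "?h ` black_star T Z = ?A"
    unfolding star image_image image_ident .
  moreover have "cyclic_on x (?h ` black_star T Z)"
  proof (rule cyclic_on_image[OF black_cyclic[OF Z]])
    fix e assume "e \<in> black_star T Z"
    then obtain k where k: "k \<in> ?A" "e = (Z, \<omega> k)"
      unfolding star by blast
    then show "x (?h e) = ?h (black_rot T e)"
      using h[OF k(1)] by (simp only: x_def if_True)
  qed
  ultimately have cyc: "cyclic_on x ?A"
    by simp
  have out: "x k = k" if "k \<notin> ?A" for k
    using that by (simp only: x_def if_False)
  \<comment> \<open>A constant fibre map makes the whole set \<open>?A\<close> a single
    fibre.\<close>
  have "bij_betw x ?A ?A"
    using finite_cyclic_on[OF cyc] cyc by (intro fibrewise_cyclic_bij[where g = "\<lambda>_. ()"]) simp_all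
  then have "x permutes ?A"
    using out by (rule bij_imp_permutes)
  then have "x permutes {1..m}"
    by (rule permutes_subset) blast
  moreover have "card ?A = card (black_star T Z)"
    unfolding star using card_image[OF inj] by simp
  ultimately show thesis
    using that cyc out x by blast
qed

text \<open>
  The sheet of an edge is its position around its white end, counted so that every edge at
  \<open>X\<close> lies on sheet 0 and every edge at \<open>Y\<close> on sheet 1.
\<close>

lemma iso_monodromy:
  assumes lab: "edge_labelling T lab" and w0: "NX \<inter> NY = {w0}"
    and orient: "white_rot T (X, w0) = (Y, w0)"
  shows "even (card (black_star T X)) \<and> even (card (black_star T Y)) \<longrightarrow>
      iso_to_semidirect_product (monodromy_group T lab)
        (alt_group (card (white T)) \<times>\<times> alt_group (card (white T)) \<times>\<times> alt_group (card (white T)))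
        (alt_group 4)"
    and "odd (card (black_star T X)) \<and> odd (card (black_star T Y)) \<longrightarrow>
      iso_to_semidirect_product (monodromy_group T lab)
        (alt_group (card (white T)) \<times>\<times> alt_group (card (white T)) \<times>\<times> alt_group (card (white T)))
        (integer_mod_group 3)"
    and "even (card (black_star T X)) \<noteq> even (card (black_star T Y)) \<longrightarrow>
      iso_to_semidirect_product (monodromy_group T lab)
        (alt_group (card (white T)) \<times>\<times> alt_group (card (white T)) \<times>\<times> alt_group (card (white T)))
        (alt_group 4 \<times>\<times> integer_mod_group 2)"
proof -
  let ?\<rho> = "white_rot T"
  define m where "m = card (white T)"
  obtain \<omega> where \<omega>: "bij_betw \<omega> {1..m} (white T)"
    using ex_bij_betw_nat_finite_1[OF finite_white] unfolding m_def by blast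
  have \<omega>_white: "\<omega> k \<in> white T" if "k \<in> {1..m}" for k
    using bij_betwE[OF \<omega>] that by blast
  \<comment> \<open>\<open>e k\<close> is the edge of sheet 0 at the white vertex
    \<open>\<omega> k\<close>. Without an edge to \<open>X\<close>, the count starts two steps after
    the edge to \<open>Y\<close>, which by \<open>(white_rot T ^^ 3)\<close> being trivial there
    puts that edge on sheet 1.\<close>
  define e where "e k = (if \<omega> k \<in> NX then (X, \<omega> k) else (?\<rho> ^^ 2) (Y, \<omega> k))" for k
  have Y_star: "(Y, w) \<in> white_star T w" if "w \<in> NY" for w
    using that by (simp add: white_star_def NY_def)
  have e_star: "e k \<in> white_star T (\<omega> k)" if k: "k \<in> {1..m}" for k
  proof (cases "\<omega> k \<in> NX")
    case True
    then show ?thesis by (simp add: e_def white_star_def NX_def)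
  next
    case False
    then have "\<omega> k \<in> NY"
      using white_near_hub \<omega>_white[OF k] by blast
    then show ?thesis
      using False cyclic_on_funpow_in[OF white_cyclic[OF \<omega>_white[OF k]] Y_star, of 2]
      by (simp add: e_def)
  qed
  note cyc3 = cyclic_on_card_3[OF white_cyclic[OF \<omega>_white] white_degree[OF \<omega>_white] e_star]
  have e_cubed: "(?\<rho> ^^ 3) (e k) = e k" if "k \<in> {1..m}" for k
    using cyc3(3) that by blast
  have e_edge: "(?\<rho> ^^ j) (e k) \<in> edges T" "snd ((?\<rho> ^^ j) (e k)) = \<omega> k" if "k \<in> {1..m}" for k j
    using cyclic_on_funpow_in[OF white_cyclic[OF \<omega>_white] e_star] that
    by (auto simp: white_star_def)
  have e_inj: "i = j" if "k \<in> {1..m}" "(?\<rho> ^^ i) (e k) = (?\<rho> ^^ j) (e k)" "i < 3" "j < 3" for i j k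
    using inj_onD[OF cyc3(2)[OF that(1,1,1)] that(2)] that(3,4) by simp
  have at_X: "e k = (X, \<omega> k)" if "\<omega> k \<in> NX" for k
    using that by (simp add: e_def)
  have at_Y: "?\<rho> (e k) = (Y, \<omega> k)" if "k \<in> {1..m}" "\<omega> k \<in> NY" for k
  proof (cases "\<omega> k \<in> NX")
    \<comment> \<open>At the common white vertex the count starts at the edge to \<open>X\<close>,
      so only \<open>orient\<close> puts the edge to \<open>Y\<close> on sheet 1.\<close>
    case True
    then have "\<omega> k = w0" using that w0 by blast
    then show ?thesis using at_X[OF True] orient by simp
  next
    case False
    have "(?\<rho> ^^ 3) (Y, \<omega> k) = (Y, \<omega> k)"
      using cyclic_on_card_3(3)[OF white_cyclic[OF \<omega>_white] white_degree[OF \<omega>_white] Y_star] that by blast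
    then show ?thesis
      using False by (simp add: e_def numeral_3_eq_3 numeral_2_eq_2)
  qed
  \<comment> \<open>Together with \<open>off_Y\<close>: each hub occurs only on its own sheet, so
    every other edge, and all of sheet 2, ends in a leaf, where \<open>black_rot\<close> is
    trivial.\<close>
  have off_X: "fst ((?\<rho> ^^ j) (e k)) \<noteq> X" if k: "k \<in> {1..m}" and j: "0 < j" "j < 3" for j k
  proof
    assume "fst ((?\<rho> ^^ j) (e k)) = X"
    then have eq: "(?\<rho> ^^ j) (e k) = (X, \<omega> k)"
      using e_edge(2)[OF k, of j] by (metis prod.collapse)
    then have "\<omega> k \<in> NX"
      using e_edge(1)[OF k, of j] by (simp add: NX_def)
    then have "(?\<rho> ^^ j) (e k) = (?\<rho> ^^ 0) (e k)"
      using eq at_X by simp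
    then show False
      using e_inj[OF k, of j 0] j by simp
  qed
  have off_Y: "fst ((?\<rho> ^^ j) (e k)) \<noteq> Y" if k: "k \<in> {1..m}" and j: "j \<noteq> 1" "j < 3" for j k
  proof
    assume "fst ((?\<rho> ^^ j) (e k)) = Y"
    then have eq: "(?\<rho> ^^ j) (e k) = (Y, \<omega> k)"
      using e_edge(2)[OF k, of j] by (metis prod.collapse)
    then have "\<omega> k \<in> NY"
      using e_edge(1)[OF k, of j] by (simp add: NY_def)
    then have "(?\<rho> ^^ j) (e k) = (?\<rho> ^^ 1) (e k)"
      using eq at_Y[OF k] by simp
    then show False
      using e_inj[OF k, of j 1] j by simp
  qed
  let ?pos = "\<lambda>(k, j). (?\<rho> ^^ j) (e k)"
  have pos: "bij_betw ?pos ({1..m} \<times> {..<3}) (edges T)"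
  proof (rule bij_betw_imageI)
    show "inj_on ?pos ({1..m} \<times> {..<3})"
    proof (rule inj_onI)
      fix z z' assume z: "z \<in> {1..m} \<times> {..<3}" "z' \<in> {1..m} \<times> {..<3}" "?pos z = ?pos z'"
      obtain k j k' j' where kj: "z = (k, j)" "z' = (k', j')"
        by (cases z, cases z')
      have *: "k \<in> {1..m}" "k' \<in> {1..m}" "j \<in> {..<3}" "j' \<in> {..<3}"
        and eq: "(?\<rho> ^^ j) (e k) = (?\<rho> ^^ j') (e k')"
        using z unfolding kj by simp_all
      have "\<omega> k = \<omega> k'"
        using e_edge(2)[OF *(1), of j] e_edge(2)[OF *(2), of j'] eq by simp
      then have "k = k'"
        using bij_betw_imp_inj_on[OF \<omega>] *(1,2) by (auto dest: inj_onD)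
      then show "z = z'"
        using e_inj[OF *(1), of j j'] eq *(3,4) kj by simp
    qed
    show "?pos ` ({1..m} \<times> {..<3}) = edges T"
    proof
      show "?pos ` ({1..m} \<times> {..<3}) \<subseteq> edges T"
        using e_edge(1) by auto
      show "edges T \<subseteq> ?pos ` ({1..m} \<times> {..<3})"
      proof
        fix d assume d: "d \<in> edges T"
        then have "snd d \<in> white T"
          using edges_subset by auto
        then obtain k where k: "k \<in> {1..m}" "snd d = \<omega> k"
          using bij_betw_imp_surj_on[OF \<omega>] by blast
        then have "d \<in> white_star T (\<omega> k)"
          using d by (simp add: white_star_def)
        then obtain j where "j \<in> {..<3}" "d = (?\<rho> ^^ j) (e k)"
          using cyc3(1)[OF k(1) k(1) k(1)] by blast
        then show "d \<in> ?pos ` ({1..m} \<times> {..<3})"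
          using k(1) by (intro image_eqI[of _ _ "(k, j)"]) simp_all
      qed
    qed
  qed
  have labij: "bij_betw lab (edges T) {1..card (edges T)}"
    using lab by (simp add: edge_labelling_def)
  have relabel: "relabel T lab f (lab d) = lab (f d)" if "d \<in> edges T" for f d
    using bij_betwE[OF labij] bij_betw_inv_into_left[OF labij] that by (simp add: relabel_def)
  let ?co = "lab \<circ> ?pos"
  note sigma = sigma_in_sym_group[OF tree lab, unfolded sym_group_carrier]
  interpret sheets "card (edges T)" m ?co "sigma1 T lab"
  proof
    show "m > 0"
      using card_white hub_degree by (simp add: m_def)
    show "bij_betw ?co ({1..m} \<times> {..<3}) {1..card (edges T)}"
      using pos labij by (rule bij_betw_trans)
    show "sigma1 T lab permutes {1..card (edges T)}"
      by (rule sigma(2))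
    fix k j assume kj: "k \<in> {1..m}" "j < (3::nat)"
    have "?\<rho> ((?\<rho> ^^ j) (e k)) = (?\<rho> ^^ (Suc j mod 3)) (e k)"
    proof (cases "Suc j = 3")
      case True
      then have "?\<rho> ((?\<rho> ^^ j) (e k)) = (?\<rho> ^^ 3) (e k)"
        by (metis funpow.simps(2) o_apply)
      then show ?thesis
        using True e_cubed[OF kj(1)] by simp
    qed (use kj(2) in simp)
    then show "sigma1 T lab (?co (k, j)) = ?co (k, Suc j mod 3)"
      using relabel[OF e_edge(1)[OF kj(1), of j]] by (simp add: sigma1_def)
  qed
  let ?A = "{k \<in> {1..m}. (X, \<omega> k) \<in> edges T}" and ?B = "{k \<in> {1..m}. (Y, \<omega> k) \<in> edges T}"
  obtain x where x: "x permutes {1..m}" "cyclic_on x ?A" "\<And>k. k \<notin> ?A \<Longrightarrow> x k = k"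
    "\<And>k. k \<in> ?A \<Longrightarrow> black_rot T (X, \<omega> k) = (X, \<omega> (x k))" "card ?A = card (black_star T X)"
    using hub_cycle[OF hubs(1) \<omega>] by blast
  obtain y where y: "y permutes {1..m}" "cyclic_on y ?B" "\<And>k. k \<notin> ?B \<Longrightarrow> y k = k"
    "\<And>k. k \<in> ?B \<Longrightarrow> black_rot T (Y, \<omega> k) = (Y, \<omega> (y k))" "card ?B = card (black_star T Y)"
    using hub_cycle[OF hubs(2) \<omega>] by blast
  have xA: "x k \<in> ?A" if "k \<in> ?A" for k
    using cyclic_on_inI[OF x(2) that] .
  have yB: "y k \<in> ?B" if "k \<in> ?B" for k
    using cyclic_on_inI[OF y(2) that] .
  have "w0 \<in> NX \<union> NY"
    using w0 by auto
  then have "w0 \<in> \<omega> ` {1..m}"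
    unfolding white_near_hub bij_betw_imp_surj_on[OF \<omega>] .
  then obtain pt where pt: "pt \<in> {1..m}" "\<omega> pt = w0"
    by (elim imageE) simp
  have "?A \<union> ?B = {k \<in> {1..m}. \<omega> k \<in> NX \<union> NY}"
    by (auto simp: NX_def NY_def)
  also have "\<dots> = {1..m}"
    unfolding white_near_hub using \<omega>_white by blast
  finally have AB: "?A \<union> ?B = {1..m}" .
  have "?A \<inter> ?B = {k \<in> {1..m}. \<omega> k \<in> NX \<inter> NY}"
    by (auto simp: NX_def NY_def)
  also have "\<dots> = {k \<in> {1..m}. \<omega> k = \<omega> pt}"
    unfolding w0 pt(2) by simp
  also have "\<dots> = {pt}"
    using inj_onD[OF bij_betw_imp_inj_on[OF \<omega>] _ _ pt(1)] pt(1) by blast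
  finally have pt_AB: "?A \<inter> ?B = {pt}" .
  have "two_cycles_axioms m ?A ?B x y pt"
    using AB pt_AB hub_degree x y by (intro two_cycles_axioms.intro) (simp_all only:)
  moreover have "sigma0 T lab (?co (k, 0)) = ?co (x k, 0)" if k: "k \<in> {1..m}" for k
  proof -
    have "black_rot T (e k) = e (x k)"
    proof (cases "k \<in> ?A")
      case True
      then have "\<omega> k \<in> NX" "\<omega> (x k) \<in> NX"
        using xA[OF True] by (simp_all add: NX_def)
      then have "e k = (X, \<omega> k)" "e (x k) = (X, \<omega> (x k))"
        by (simp_all only: at_X)
      then show ?thesis using x(4)[OF True] by (simp only:)
    next
      case False
      then have "fst (e k) \<noteq> X"
        using e_edge[OF k, of 0] k by (cases "e k") auto
      then show ?thesis
        using leaf_rot[of "e k"] e_edge(1)[OF k, of 0] off_Y[OF k, of 0] x(3)[OF False] by simp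
    qed
    then show ?thesis
      using relabel[OF e_edge(1)[OF k, of 0]] by (simp add: sigma0_def)
  qed
  moreover have "sigma0 T lab (?co (k, 1)) = ?co (y k, 1)" if k: "k \<in> {1..m}" for k
  proof -
    have "black_rot T (?\<rho> (e k)) = ?\<rho> (e (y k))"
    proof (cases "k \<in> ?B")
      case True
      then have "\<omega> k \<in> NY" "\<omega> (y k) \<in> NY" "y k \<in> {1..m}"
        using yB[OF True] by (simp_all add: NY_def)
      then have "?\<rho> (e k) = (Y, \<omega> k)" "?\<rho> (e (y k)) = (Y, \<omega> (y k))"
        using k by (simp_all only: at_Y)
      then show ?thesis using y(4)[OF True] by (simp only:)
    next
      case False
      then have "fst (?\<rho> (e k)) \<noteq> Y"
        using e_edge[OF k, of 1] k by (cases "?\<rho> (e k)") auto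
      then show ?thesis
        using leaf_rot[of "?\<rho> (e k)"] e_edge(1)[OF k, of 1] off_X[OF k, of 1] y(3)[OF False] by simp
    qed
    then show ?thesis
      using relabel[OF e_edge(1)[OF k, of 1]] by (simp add: sigma0_def)
  qed
  moreover have "sigma0 T lab (?co (k, 2)) = ?co (k, 2)" if k: "k \<in> {1..m}" for k
  proof -
    have "black_rot T ((?\<rho> ^^ 2) (e k)) = (?\<rho> ^^ 2) (e k)"
      using e_edge(1)[OF k] off_X[OF k, of 2] off_Y[OF k, of 2] by (intro leaf_rot) simp_all
    then show ?thesis
      using relabel[OF e_edge(1)[OF k, of 2]] by (simp add: sigma0_def)
  qed
  ultimately show "even (card (black_star T X)) \<and> even (card (black_star T Y)) \<longrightarrow>
      iso_to_semidirect_product (monodromy_group T lab)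
        (alt_group (card (white T)) \<times>\<times> alt_group (card (white T)) \<times>\<times> alt_group (card (white T)))
        (alt_group 4)"
    and "odd (card (black_star T X)) \<and> odd (card (black_star T Y)) \<longrightarrow>
      iso_to_semidirect_product (monodromy_group T lab)
        (alt_group (card (white T)) \<times>\<times> alt_group (card (white T)) \<times>\<times> alt_group (card (white T)))
        (integer_mod_group 3)"
    and "even (card (black_star T X)) \<noteq> even (card (black_star T Y)) \<longrightarrow>
      iso_to_semidirect_product (monodromy_group T lab)
        (alt_group (card (white T)) \<times>\<times> alt_group (card (white T)) \<times>\<times> alt_group (card (white T)))
        (alt_group 4 \<times>\<times> integer_mod_group 2)"
    using iso_monodromy[OF sigma(1), of x y ?A ?B pt] unfolding monodromy_group_def m_def[symmetric] x(5) y(5)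
    by blast+
qed

end

section \<open>From the passport to the two hubs and their order\<close>

theorem lemma6p2:
  fixes r s p t n :: nat
    and T :: "('b, 'w) bicolored_graph"
    and lab :: "'b \<times> 'w \<Rightarrow> nat"
  assumes "r \<noteq> s" and "r \<ge> 2" and "s \<ge> 2"
    and "p > 0" and "t > 0" and "n > 0"
    and "n = 3 * p" and "n = r + s + t" and "p + t + 2 = n + 1"
    and "bicolored_plane_tree T"
    and "passport T = ({#r, s#} + replicate_mset t 1, replicate_mset p 3, n)"
    and "edge_labelling T lab"
  shows "(even r \<and> even s \<longrightarrow>
            iso_to_semidirect_product (monodromy_group T lab)
              (alt_group p \<times>\<times> alt_group p \<times>\<times> alt_group p)
              (alt_group 4)) \<and>
         (odd r \<and> odd s \<longrightarrow>
            iso_to_semidirect_product (monodromy_group T lab)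
              (alt_group p \<times>\<times> alt_group p \<times>\<times> alt_group p)
              (integer_mod_group 3)) \<and>
         (even r \<noteq> even s \<longrightarrow>
            iso_to_semidirect_product (monodromy_group T lab)
              (alt_group p \<times>\<times> alt_group p \<times>\<times> alt_group p)
              (alt_group 4 \<times>\<times> integer_mod_group 2))"
proof -
  let ?deg = "\<lambda>b. card (black_star T b)"
  have fin: "finite (black T)" "finite (white T)"
    using \<open>bicolored_plane_tree T\<close> by (simp_all add: bicolored_plane_tree_def)
  have black: "image_mset ?deg (mset_set (black T)) = add_mset r (add_mset s (replicate_mset t 1))"
    and white: "image_mset (\<lambda>w. card (white_star T w)) (mset_set (white T)) = replicate_mset p 3"
    using \<open>passport T = _\<close> by (simp_all add: passport_def)
  obtain X where X: "X \<in> black T" "?deg X = r"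
    "image_mset ?deg (mset_set (black T - {X})) = add_mset s (replicate_mset t 1)"
    using image_mset_mset_set_eq_add_mset[OF fin(1) black] by blast
  obtain Y where Y: "Y \<in> black T - {X}" "?deg Y = s"
    "image_mset ?deg (mset_set (black T - {X} - {Y})) = replicate_mset t 1"
    using image_mset_mset_set_eq_add_mset[OF _ X(3)] fin(1) by blast
  have leaf: "?deg b = 1" if "b \<in> black T" "b \<noteq> X" "b \<noteq> Y" for b
    using image_mset_mset_set_eq_replicate(2)[OF _ Y(3)] fin(1) that by simp
  have p: "card (white T) = p"
    using image_mset_mset_set_eq_replicate(1)[OF fin(2) white] .
  have deg3: "card (white_star T w) = 3" if "w \<in> white T" for w
    using image_mset_mset_set_eq_replicate(2)[OF fin(2) white that] .
  \<comment> \<open>Eliminating \<open>n\<close> and \<open>t\<close> from the degree sums and the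
    Euler relation leaves this single equation, which becomes \<open>card_white\<close>.\<close>
  have rs: "r + s = p + 1"
    using assms(7-9) by linarith
  interpret XY: two_hubs T X Y
    using assms X Y leaf deg3 p rs by unfold_locales auto
  interpret YX: two_hubs T Y X
    using assms X Y leaf deg3 p rs by unfold_locales auto
  have swap: "YX.NX = XY.NY" "YX.NY = XY.NX"
    unfolding XY.NX_def XY.NY_def YX.NX_def YX.NY_def by simp_all
  obtain w where w: "XY.NX \<inter> XY.NY = {w}"
    by (rule XY.central)
  then have w_white: "w \<in> white T" and Xw: "(X, w) \<in> white_star T w" and Yw: "(Y, w) \<in> white_star T w"
    using XY.white_near_hub by (auto simp: white_star_def XY.NX_def XY.NY_def)
  note cyc3 = cyclic_on_card_3[OF XY.white_cyclic[OF w_white] deg3[OF w_white] Xw]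
  obtain j where j: "j < 3" "(Y, w) = (white_rot T ^^ j) (X, w)"
    using Yw cyc3(1) by auto
  have "j \<noteq> 0"
    using j(2) Y(1) by (intro notI) simp
  then consider "j = 1" | "j = 2"
    using j(1) by linarith
  then show ?thesis
  proof cases
    case 1
    then have "white_rot T (X, w) = (Y, w)"
      using j(2) by simp
    then show ?thesis
      using XY.iso_monodromy[OF \<open>edge_labelling T lab\<close> w] unfolding X(2) Y(2) p by blast
  next
    case 2
    \<comment> \<open>At a white vertex of degree 3, two steps from \<open>X\<close> to
      \<open>Y\<close> leave one step from \<open>Y\<close> back to \<open>X\<close>, so the
      orientation condition holds with the hubs exchanged. The three cases of the conclusion are
      symmetric in \<open>r\<close> and \<open>s\<close>.\<close>
    then have "white_rot T (Y, w) = (white_rot T ^^ 3) (X, w)"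
      using j(2) by (simp add: numeral_3_eq_3 numeral_2_eq_2)
    then have "white_rot T (Y, w) = (X, w)"
      using cyc3(3) by simp
    moreover have "YX.NX \<inter> YX.NY = {w}"
      using w unfolding swap by blast
    ultimately show ?thesis
      using YX.iso_monodromy[OF \<open>edge_labelling T lab\<close>] unfolding X(2) Y(2) p by blast
  qed
qed

end
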